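(* Let $R$ be a commutative unital ring and let $M$ be a finitely generated $R$-module, equipped with the induced Zariski topology. The following are equivalent: (1) $\sigma_{\tau}(M,R)$ is finite. (2) $\sigma_{\tau}(M,R)=2$. (Equivalently, $M$ is reducible in the induced Zariski topology.) (3) $\sigma(M,R)$ is finite.
   Context: No assumption is made on the cardinalities of the residue fields of $R$. $\mathrm{mSpec}(R)$ is the set of maximal ideals of $R$, and $S_M=\{\mathfrak{m}\in\mathrm{mSpec}(R):\dim_{R/\mathfrak{m}}(M/\mathfrak{m}M)\ge 2\}$. Induced Zariski topology on a finite-dimensional vector space $V$ over a (finite or infinite) field $\mathbf{K}$: identify $V$ with $\mathbf{K}^n$ by a basis; closed sets are the common zero sets of families of polynomials in $\mathbf{K}[X_1,\dots,X_n]$ (independent of the basis). Induced Zariski topology on a finitely generated $R$-module $M$: topologize each $M/\mathfrak{m}M$ with the induced Zariski topology as an $R/\mathfrak{m}$-vector space if $\mathfrak{m}\in S_M$, and with the topology whose only closed sets are $\emptyset,\{0\},M/\mathfrak{m}M$ if $\mathfrak{m}\notin S_M$; give $\prod_{\mathfrak{m}\in\mathrm{mSpec}(R)}M/\mathfrak{m}M$ the product topology; and give $M$ the coarsest topology making the natural map $M\to\prod_{\mathfrak{m}\in\mathrm{mSpec}(R)}M/\mathfrak{m}M$ continuous. $\sigma(M,R)$ is the minimum cardinal number of proper $R$-submodules of $M$ whose union is $M$; $\sigma_\tau(M,R)$ is the minimum cardinal number of proper closed subsets of $M$ (induced Zariski topology) whose union is $M$. Either being finite means that a finite cover of the corresponding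 kind exists. A space is reducible if it is the union of two proper closed subsets. *)

theory Defs
  imports "HOL-Analysis.Function_Topology" "HOL-Algebra.Indexed_Polynomials"
begin

unbundle cardinal_syntax

section \<open>Modules and quotients\<close>

definition module_span :: "('a, 'm) ring_scheme \<Rightarrow> ('a, 'b, 'n) module_scheme \<Rightarrow> 'b set \<Rightarrow> 'b set"
  where "module_span R M A = \<Inter> {N. submodule N R M \<and> A \<subseteq> N}"

definition fin_gen_module :: "('a, 'm) ring_scheme \<Rightarrow> ('a, 'b, 'n) module_scheme \<Rightarrow> bool"
  where "fin_gen_module R M \<longleftrightarrow>
    (\<exists>A. finite A \<and> A \<subseteq> carrier M \<and> module_span R M A = carrier M)"

definition ideal_smult :: "('a, 'm) ring_scheme \<Rightarrow> ('a, 'b, 'n) module_scheme \<Rightarrow> 'a set \<Rightarrow> 'b set"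
  where "ideal_smult R M I =
    module_span R M {a \<odot>\<^bsub>M\<^esub> x | a x. a \<in> I \<and> x \<in> carrier M}"

text \<open>The quotient \<open>M/IM\<close>, with scalars from \<open>R Quot I\<close>, whose elements are cosets of \<open>I\<close>; the
  scalar multiplication follows the pattern of the multiplication of \<^const>\<open>FactRing\<close>.
  The fields \<open>mult\<close> and \<open>one\<close> of a module record play no role.\<close>

definition quot_module ::
  "('a, 'm) ring_scheme \<Rightarrow> ('a, 'b, 'n) module_scheme \<Rightarrow> 'a set \<Rightarrow> ('a set, 'b set) module"
  where "quot_module R M I =
    \<lparr>carrier = a_rcosets\<^bsub>M\<^esub> (ideal_smult R M I), monoid.mult = undefined, one = undefined,
     zero = ideal_smult R M I, add = set_add M,
     smult = (\<lambda>A Y. \<Union>a\<in>A. \<Union>y\<in>Y. ideal_smult R M I +>\<^bsub>M\<^esub> (a \<odot>\<^bsub>M\<^esub> y))\<rparr>"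

definition mSpec :: "('a, 'm) ring_scheme \<Rightarrow> 'a set set"
  where "mSpec R = {I. maximalideal I R}"

section \<open>Bases and coordinates\<close>

definition coords :: "('k, 'm) ring_scheme \<Rightarrow> nat \<Rightarrow> (nat \<Rightarrow> 'k) set"
  where "coords K n = {..<n} \<rightarrow>\<^sub>E carrier K"

definition lin_comb :: "('k, 'v, 'n) module_scheme \<Rightarrow> 'v list \<Rightarrow> (nat \<Rightarrow> 'k) \<Rightarrow> 'v"
  where "lin_comb V bs c = (\<Oplus>\<^bsub>V\<^esub>i\<in>{..<length bs}. c i \<odot>\<^bsub>V\<^esub> (bs ! i))"

definition is_basis :: "('k, 'm) ring_scheme \<Rightarrow> ('k, 'v, 'n) module_scheme \<Rightarrow> 'v list \<Rightarrow> bool"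
  where "is_basis K V bs \<longleftrightarrow> set bs \<subseteq> carrier V
    \<and> (\<forall>c \<in> coords K (length bs). lin_comb V bs c = \<zero>\<^bsub>V\<^esub> \<longrightarrow> (\<forall>i<length bs. c i = \<zero>\<^bsub>K\<^esub>))
    \<and> (\<forall>v \<in> carrier V. \<exists>c \<in> coords K (length bs). v = lin_comb V bs c)"

text \<open>Only used for finite-dimensional spaces, where a basis exists.\<close>

definition some_basis :: "('k, 'm) ring_scheme \<Rightarrow> ('k, 'v, 'n) module_scheme \<Rightarrow> 'v list"
  where "some_basis K V = (SOME bs. is_basis K V bs)"

definition vdim :: "('k, 'm) ring_scheme \<Rightarrow> ('k, 'v, 'n) module_scheme \<Rightarrow> nat"
  where "vdim K V = length (some_basis K V)"

section \<open>The Zariski topology on a finite-dimensional vector space\<close>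

text \<open>\<open>K[X\<^sub>0,\<dots>,X\<^sub>n\<^sub>-\<^sub>1]\<close> is the set \<^const>\<open>ring.indexed_pset\<close> of the library, whose elements
  assign a coefficient to every monomial, a monomial being a multiset of variables.\<close>

definition mpolys :: "('k, 'm) ring_scheme \<Rightarrow> nat \<Rightarrow> (nat multiset \<Rightarrow> 'k) set"
  where "mpolys K n = ring.indexed_pset K {..<n} (carrier K)"

definition mpoly_eval :: "('k, 'm) ring_scheme \<Rightarrow> (nat multiset \<Rightarrow> 'k) \<Rightarrow> (nat \<Rightarrow> 'k) \<Rightarrow> 'k"
  where "mpoly_eval K p c = (\<Oplus>\<^bsub>K\<^esub>m\<in>{m. p m \<noteq> \<zero>\<^bsub>K\<^esub>}.
    p m \<otimes>\<^bsub>K\<^esub> (\<Otimes>\<^bsub>K\<^esub>i\<in>set_mset m. c i [^]\<^bsub>K\<^esub> count m i))"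

definition zero_set :: "('k, 'm) ring_scheme \<Rightarrow> nat \<Rightarrow> (nat multiset \<Rightarrow> 'k) set \<Rightarrow> (nat \<Rightarrow> 'k) set"
  where "zero_set K n F = {c \<in> coords K n. \<forall>p\<in>F. mpoly_eval K p c = \<zero>\<^bsub>K\<^esub>}"

definition zariski_closed ::
  "('k, 'm) ring_scheme \<Rightarrow> ('k, 'v, 'n) module_scheme \<Rightarrow> 'v list \<Rightarrow> 'v set \<Rightarrow> bool"
  where "zariski_closed K V bs Z \<longleftrightarrow>
    (\<exists>F \<subseteq> mpolys K (length bs). Z = lin_comb V bs ` zero_set K (length bs) F)"

definition zariski_topology ::
  "('k, 'm) ring_scheme \<Rightarrow> ('k, 'v, 'n) module_scheme \<Rightarrow> 'v topology"
  where "zariski_topology K V = topology (\<lambda>U. U \<subseteq> carrier V \<and>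
    zariski_closed K V (some_basis K V) (carrier V - U))"

definition three_set_topology :: "('k, 'v, 'n) module_scheme \<Rightarrow> 'v topology"
  where "three_set_topology V = topology (\<lambda>U. U \<subseteq> carrier V \<and>
    carrier V - U \<in> {{}, {\<zero>\<^bsub>V\<^esub>}, carrier V})"

section \<open>The induced Zariski topology on a module\<close>

definition S_set :: "('a, 'm) ring_scheme \<Rightarrow> ('a, 'b, 'n) module_scheme \<Rightarrow> 'a set set"
  where "S_set R M = {I \<in> mSpec R. 2 \<le> vdim (R Quot I) (quot_module R M I)}"

definition fibre_topology ::
  "('a, 'm) ring_scheme \<Rightarrow> ('a, 'b, 'n) module_scheme \<Rightarrow> 'a set \<Rightarrow> 'b set topology"
  where "fibre_topology R M I =
    (if I \<in> S_set R M then zariski_topology (R Quot I) (quot_module R M I)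
     else three_set_topology (quot_module R M I))"

definition induced_zariski ::
  "('a, 'm) ring_scheme \<Rightarrow> ('a, 'b, 'n) module_scheme \<Rightarrow> 'b topology"
  where "induced_zariski R M =
    pullback_topology (carrier M) (\<lambda>x. \<lambda>I\<in>mSpec R. ideal_smult R M I +>\<^bsub>M\<^esub> x)
      (product_topology (fibre_topology R M) (mSpec R))"

definition reducible_space :: "'b topology \<Rightarrow> bool"
  where "reducible_space T \<longleftrightarrow> (\<exists>A B. closedin T A \<and> A \<noteq> topspace T \<and>
    closedin T B \<and> B \<noteq> topspace T \<and> A \<union> B = topspace T)"

section \<open>Covering numbers\<close>

text \<open>\<open>\<kappa>\<close> is the minimum cardinal of a subfamily of \<open>\<P>\<close> with union \<open>S\<close>. This is a relation
  because there may be no such subfamily.\<close>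

definition is_covering_number :: "'b set set \<Rightarrow> 'b set \<Rightarrow> 'c rel \<Rightarrow> bool"
  where "is_covering_number \<P> S \<kappa> \<longleftrightarrow> Card_order \<kappa>
    \<and> (\<exists>\<C> \<subseteq> \<P>. \<Union>\<C> = S \<and> |\<C>| =o \<kappa>)
    \<and> (\<forall>\<C> \<subseteq> \<P>. \<Union>\<C> = S \<longrightarrow> \<kappa> \<le>o |\<C>| )"

definition is_sigma :: "('a, 'm) ring_scheme \<Rightarrow> ('a, 'b, 'n) module_scheme \<Rightarrow> 'c rel \<Rightarrow> bool"
  where "is_sigma R M \<kappa> \<longleftrightarrow>
    is_covering_number {N. submodule N R M \<and> N \<noteq> carrier M} (carrier M) \<kappa>"

definition is_sigma_tau :: "('a, 'm) ring_scheme \<Rightarrow> ('a, 'b, 'n) module_scheme \<Rightarrow> 'c rel \<Rightarrow> bool"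
  where "is_sigma_tau R M \<kappa> \<longleftrightarrow>
    is_covering_number {C. closedin (induced_zariski R M) C \<and> C \<noteq> carrier M} (carrier M) \<kappa>"

text \<open>Cardinals on the type \<open>'b set\<close> suffice, as covers of \<open>M\<close> have type \<open>'b set set\<close>.\<close>

definition sigma_fin :: "('a, 'm) ring_scheme \<Rightarrow> ('a, 'b, 'n) module_scheme \<Rightarrow> bool"
  where "sigma_fin R M \<longleftrightarrow> (\<exists>\<kappa> :: 'b set rel. is_sigma R M \<kappa> \<and> BNF_Cardinal_Arithmetic.cfinite \<kappa>)"

definition sigma_tau_fin :: "('a, 'm) ring_scheme \<Rightarrow> ('a, 'b, 'n) module_scheme \<Rightarrow> bool"
  where "sigma_tau_fin R M \<longleftrightarrow> (\<exists>\<kappa> :: 'b set rel. is_sigma_tau R M \<kappa> \<and> BNF_Cardinal_Arithmetic.cfinite \<kappa>)"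

section \<open>Consistency of the definitions\<close>

text \<open>The quotient module is a module, the Zariski closed sets are the closed sets of a topology and
  do not depend on the basis, and the three-set family is a topology.\<close>

lemma (in Module.module) module_span_submodule:
  assumes "A \<subseteq> carrier M" shows "submodule (module_span R M A) R M"
proof (rule submoduleI)
  show "module_span R M A \<subseteq> carrier M"
    using assms carrier_is_submodule unfolding module_span_def by blast
next
  show "\<zero>\<^bsub>M\<^esub> \<in> module_span R M A"
    unfolding module_span_def
    by (auto simp: submodule_def dest: subgroup.one_closed)
next
  fix a assume "a \<in> module_span R M A" thus "\<ominus>\<^bsub>M\<^esub> a \<in> module_span R M A"
    unfolding module_span_def by (auto intro: submoduleE(3))
next
  fix a b assume "a \<in> module_span R M A" "b \<in> module_span R M A"
  thus "a \<oplus>\<^bsub>M\<^esub> b \<in> module_span R M A"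
    unfolding module_span_def by (auto intro: submoduleE(5))
next
  fix a x assume "a \<in> carrier R" "x \<in> module_span R M A"
  thus "a \<odot>\<^bsub>M\<^esub> x \<in> module_span R M A"
    unfolding module_span_def by (auto intro: submoduleE(4))
qed

lemma (in Module.module) ideal_smult_submodule:
  assumes "I \<subseteq> carrier R" shows "submodule (ideal_smult R M I) R M"
  unfolding ideal_smult_def by (rule module_span_submodule) (use assms in auto)

lemma ideal_smultI:
  "a \<in> I \<Longrightarrow> x \<in> carrier M \<Longrightarrow> a \<odot>\<^bsub>M\<^esub> x \<in> ideal_smult R M I"
  unfolding ideal_smult_def module_span_def by blast

lemma (in Module.module) quot_module_smult:
  assumes I: "ideal I R" and a: "a \<in> carrier R" and x: "x \<in> carrier M"
  shows "(I +>\<^bsub>R\<^esub> a) \<odot>\<^bsub>quot_module R M I\<^esub> (ideal_smult R M I +>\<^bsub>M\<^esub> x)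
    = ideal_smult R M I +>\<^bsub>M\<^esub> (a \<odot>\<^bsub>M\<^esub> x)"
proof -
  interpret I: ideal I R by fact
  let ?N = "ideal_smult R M I"
  have subI: "I \<subseteq> carrier R" using I.a_subset by blast
  note N = submoduleE[OF ideal_smult_submodule[OF subI]]
  interpret N: subgroup ?N "add_monoid M"
    using ideal_smult_submodule[OF subI] by (simp add: submodule_def)
  interpret AG: additive_subgroup ?N M by unfold_locales
  interpret ab: abelian_subgroup ?N M
    by (intro abelian_subgroupI3 AG.additive_subgroup_axioms M.abelian_group_axioms)
  have *: "?N +>\<^bsub>M\<^esub> ((i \<oplus> a) \<odot>\<^bsub>M\<^esub> (n \<oplus>\<^bsub>M\<^esub> x)) = ?N +>\<^bsub>M\<^esub> (a \<odot>\<^bsub>M\<^esub> x)"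
    if i: "i \<in> I" and n: "n \<in> ?N" for i n
  proof -
    have ic: "i \<in> carrier R" and nc: "n \<in> carrier M" using i n subI N(1) by auto
    have "(i \<oplus> a) \<odot>\<^bsub>M\<^esub> (n \<oplus>\<^bsub>M\<^esub> x) = (i \<odot>\<^bsub>M\<^esub> (n \<oplus>\<^bsub>M\<^esub> x) \<oplus>\<^bsub>M\<^esub> a \<odot>\<^bsub>M\<^esub> n) \<oplus>\<^bsub>M\<^esub> a \<odot>\<^bsub>M\<^esub> x"
      using ic nc a x by (simp add: smult_l_distr smult_r_distr M.a_ac)
    moreover have "i \<odot>\<^bsub>M\<^esub> (n \<oplus>\<^bsub>M\<^esub> x) \<oplus>\<^bsub>M\<^esub> a \<odot>\<^bsub>M\<^esub> n \<in> ?N"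
      using i n nc x a by (intro N(5) N(4) ideal_smultI) auto
    ultimately have "(i \<oplus> a) \<odot>\<^bsub>M\<^esub> (n \<oplus>\<^bsub>M\<^esub> x) \<in> ?N +>\<^bsub>M\<^esub> (a \<odot>\<^bsub>M\<^esub> x)"
      unfolding a_r_coset_def' by blast
    thus ?thesis
      using a x by (intro M.a_repr_independence[symmetric]) (auto intro: N.subgroup_axioms)
  qed
  have ne: "\<zero> \<in> I" "\<zero>\<^bsub>M\<^esub> \<in> ?N" using AG.zero_closed by auto
  show ?thesis
  proof -
    have A: "I +> a = (\<lambda>i. i \<oplus> a) ` I" and X: "?N +>\<^bsub>M\<^esub> x = (\<lambda>n. n \<oplus>\<^bsub>M\<^esub> x) ` ?N"
      by (auto simp: a_r_coset_def')
    have "(\<Union>b\<in>I +> a. \<Union>y\<in>?N +>\<^bsub>M\<^esub> x. ?N +>\<^bsub>M\<^esub> (b \<odot>\<^bsub>M\<^esub> y))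
      = (\<Union>i\<in>I. \<Union>n\<in>?N. ?N +>\<^bsub>M\<^esub> ((i \<oplus> a) \<odot>\<^bsub>M\<^esub> (n \<oplus>\<^bsub>M\<^esub> x)))"
      unfolding A X by simp
    also have "\<dots> = (\<Union>i\<in>I. \<Union>n\<in>?N. ?N +>\<^bsub>M\<^esub> (a \<odot>\<^bsub>M\<^esub> x))"
      by (intro SUP_cong refl *)
    also have "\<dots> = ?N +>\<^bsub>M\<^esub> (a \<odot>\<^bsub>M\<^esub> x)" using ne by blast
    finally show ?thesis by (simp add: quot_module_def)
  qed
qed

lemma (in Module.module) quot_module_module:
  assumes I: "ideal I R"
  shows "Module.module (R Quot I) (quot_module R M I)"
proof -
  interpret I: ideal I R by fact
  let ?N = "ideal_smult R M I" and ?Q = "quot_module R M I"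
  have subI: "I \<subseteq> carrier R" using I.a_subset by blast
  interpret N: subgroup ?N "add_monoid M"
    using ideal_smult_submodule[OF subI] by (simp add: submodule_def)
  interpret AG: additive_subgroup ?N M by unfold_locales
  interpret ab: abelian_subgroup ?N M
    by (intro abelian_subgroupI3 AG.additive_subgroup_axioms M.abelian_group_axioms)
  note sm = quot_module_smult[OF I]
  have cR: "\<exists>a\<in>carrier R. A = I +> a" if "A \<in> carrier (R Quot I)" for A
    using that by (auto simp: FactRing_def A_RCOSETS_def')
  have cM: "\<exists>x\<in>carrier M. Y = ?N +>\<^bsub>M\<^esub> x" if "Y \<in> carrier ?Q" for Y
    using that by (auto simp: quot_module_def A_RCOSETS_def')
  have inQ: "?N +>\<^bsub>M\<^esub> x \<in> carrier ?Q" if "x \<in> carrier M" for x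
    using that by (auto simp: quot_module_def A_RCOSETS_def')
  have addQ: "(?N +>\<^bsub>M\<^esub> x) \<oplus>\<^bsub>?Q\<^esub> (?N +>\<^bsub>M\<^esub> y) = ?N +>\<^bsub>M\<^esub> (x \<oplus>\<^bsub>M\<^esub> y)"
    if "x \<in> carrier M" "y \<in> carrier M" for x y
    using ab.a_rcos_sum[OF that] by (simp add: quot_module_def)
  have addR: "(I +> x) \<oplus>\<^bsub>R Quot I\<^esub> (I +> y) = I +> (x \<oplus> y)"
    if "x \<in> carrier R" "y \<in> carrier R" for x y
    using I.a_rcos_sum[OF that] by (simp add: FactRing_def)
  have multR: "(I +> x) \<otimes>\<^bsub>R Quot I\<^esub> (I +> y) = I +> (x \<otimes> y)"
    if "x \<in> carrier R" "y \<in> carrier R" for x y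
    using I.rcoset_mult_add[OF that] by (simp add: FactRing_def)
  show ?thesis
  proof (rule moduleI)
    show "cring (R Quot I)" by (rule I.quotient_is_cring) (rule R.is_cring)
    have zQ: "\<zero>\<^bsub>?Q\<^esub> = ?N +>\<^bsub>M\<^esub> \<zero>\<^bsub>M\<^esub>"
      using M.a_coset_add_zero[OF N.subset[simplified]] by (simp add: quot_module_def)
    show "abelian_group ?Q"
    proof (rule abelian_groupI)
      show "\<zero>\<^bsub>?Q\<^esub> \<in> carrier ?Q" by (simp add: zQ inQ)
    next
      fix A assume "A \<in> carrier ?Q"
      with cM obtain x where x: "x \<in> carrier M" "A = ?N +>\<^bsub>M\<^esub> x" by meson
      thus "\<zero>\<^bsub>?Q\<^esub> \<oplus>\<^bsub>?Q\<^esub> A = A" by (simp add: zQ addQ)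
      show "\<exists>B\<in>carrier ?Q. B \<oplus>\<^bsub>?Q\<^esub> A = \<zero>\<^bsub>?Q\<^esub>"
        using x by (intro bexI[of _ "?N +>\<^bsub>M\<^esub> (\<ominus>\<^bsub>M\<^esub> x)"]) (simp_all add: zQ addQ inQ M.l_neg)
    next
      fix A B assume "A \<in> carrier ?Q" "B \<in> carrier ?Q"
      with cM obtain x y where "x \<in> carrier M" "A = ?N +>\<^bsub>M\<^esub> x" "y \<in> carrier M" "B = ?N +>\<^bsub>M\<^esub> y" by meson
      thus "A \<oplus>\<^bsub>?Q\<^esub> B \<in> carrier ?Q" "A \<oplus>\<^bsub>?Q\<^esub> B = B \<oplus>\<^bsub>?Q\<^esub> A"
        by (simp_all add: addQ inQ M.a_comm)
    next
      fix A B C assume "A \<in> carrier ?Q" "B \<in> carrier ?Q" "C \<in> carrier ?Q"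
      with cM obtain x y z where "x \<in> carrier M" "A = ?N +>\<^bsub>M\<^esub> x" "y \<in> carrier M" "B = ?N +>\<^bsub>M\<^esub> y"
        "z \<in> carrier M" "C = ?N +>\<^bsub>M\<^esub> z" by meson
      thus "(A \<oplus>\<^bsub>?Q\<^esub> B) \<oplus>\<^bsub>?Q\<^esub> C = A \<oplus>\<^bsub>?Q\<^esub> (B \<oplus>\<^bsub>?Q\<^esub> C)"
        by (simp add: addQ M.a_assoc)
    qed
  next
    fix A Y assume "A \<in> carrier (R Quot I)" "Y \<in> carrier ?Q"
    with cR cM obtain a y where "a \<in> carrier R" "A = I +> a" "y \<in> carrier M" "Y = ?N +>\<^bsub>M\<^esub> y" by meson
    thus "A \<odot>\<^bsub>?Q\<^esub> Y \<in> carrier ?Q" by (simp add: sm inQ)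
  next
    fix A B Y assume "A \<in> carrier (R Quot I)" "B \<in> carrier (R Quot I)" "Y \<in> carrier ?Q"
    with cR cM obtain a b y where "a \<in> carrier R" "A = I +> a" "b \<in> carrier R" "B = I +> b"
      "y \<in> carrier M" "Y = ?N +>\<^bsub>M\<^esub> y" by meson
    thus "(A \<oplus>\<^bsub>R Quot I\<^esub> B) \<odot>\<^bsub>?Q\<^esub> Y = A \<odot>\<^bsub>?Q\<^esub> Y \<oplus>\<^bsub>?Q\<^esub> B \<odot>\<^bsub>?Q\<^esub> Y"
      "(A \<otimes>\<^bsub>R Quot I\<^esub> B) \<odot>\<^bsub>?Q\<^esub> Y = A \<odot>\<^bsub>?Q\<^esub> (B \<odot>\<^bsub>?Q\<^esub> Y)"
      by (simp_all add: sm addQ addR multR smult_l_distr smult_assoc1)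
  next
    fix A Y Z assume "A \<in> carrier (R Quot I)" "Y \<in> carrier ?Q" "Z \<in> carrier ?Q"
    with cR cM obtain a y z where "a \<in> carrier R" "A = I +> a" "z \<in> carrier M" "Z = ?N +>\<^bsub>M\<^esub> z"
      "y \<in> carrier M" "Y = ?N +>\<^bsub>M\<^esub> y" by meson
    thus "A \<odot>\<^bsub>?Q\<^esub> (Y \<oplus>\<^bsub>?Q\<^esub> Z) = A \<odot>\<^bsub>?Q\<^esub> Y \<oplus>\<^bsub>?Q\<^esub> A \<odot>\<^bsub>?Q\<^esub> Z"
      by (simp add: sm addQ smult_r_distr)
  next
    fix Y assume "Y \<in> carrier ?Q"
    with cM obtain y where y: "y \<in> carrier M" "Y = ?N +>\<^bsub>M\<^esub> y" by meson
    have "\<one>\<^bsub>R Quot I\<^esub> = I +> \<one>" by (simp add: FactRing_def)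
    thus "\<one>\<^bsub>R Quot I\<^esub> \<odot>\<^bsub>?Q\<^esub> Y = Y" using y by (simp add: sm)
  qed
qed

subsection \<open>Polynomial evaluation\<close>

definition mon_eval :: "('k, 'm) ring_scheme \<Rightarrow> (nat \<Rightarrow> 'k) \<Rightarrow> nat multiset \<Rightarrow> 'k"
  where "mon_eval K c m = (\<Otimes>\<^bsub>K\<^esub>i\<in>set_mset m. c i [^]\<^bsub>K\<^esub> count m i)"

lemma (in cring) mon_eval_closed [simp]:
  assumes "\<And>i. i \<in># m \<Longrightarrow> c i \<in> carrier R" shows "mon_eval R c m \<in> carrier R"
  unfolding mon_eval_def by (rule finprod_closed) (use assms in auto)

lemma (in cring) mon_eval_empty [simp]: "mon_eval R c {#} = \<one>"
  by (simp add: mon_eval_def)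

lemma (in cring) mon_eval_add_mset:
  assumes c: "\<And>j. j \<in># m \<Longrightarrow> c j \<in> carrier R" "c i \<in> carrier R"
  shows "mon_eval R c (add_mset i m) = mon_eval R c m \<otimes> c i"
proof -
  let ?S = "insert i (set_mset m)" and ?T = "set_mset m - {i}"
  let ?f = "\<lambda>j. c j [^] count m j" and ?g = "\<lambda>j. c j [^] count (add_mset i m) j"
  have S: "?S = insert i ?T" by auto
  have cl: "?f \<in> ?T \<rightarrow> carrier R" "?g \<in> ?T \<rightarrow> carrier R" using c by auto
  have 1: "mon_eval R c m = finprod R ?f ?S"
    unfolding mon_eval_def
    by (rule finprod_mono_neutral_cong_left) (use c in \<open>auto simp: not_in_iff\<close>)
  also have "\<dots> = ?f i \<otimes> finprod R ?f ?T"
    unfolding S by (rule finprod_insert) (use c cl in auto)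
  finally have m: "mon_eval R c m = ?f i \<otimes> finprod R ?f ?T" .
  have "mon_eval R c (add_mset i m) = finprod R ?g (insert i ?T)"
    unfolding mon_eval_def using S by simp
  also have "\<dots> = ?g i \<otimes> finprod R ?g ?T"
    by (rule finprod_insert) (use c cl in auto)
  also have "finprod R ?g ?T = finprod R ?f ?T"
    by (rule finprod_cong') (use cl in auto)
  finally show ?thesis
    unfolding m using c cl by (simp add: m_ac finprod_closed)
qed

lemma mpoly_eval_mon:
  "mpoly_eval K p c = (\<Oplus>\<^bsub>K\<^esub>m\<in>{m. p m \<noteq> \<zero>\<^bsub>K\<^esub>}. p m \<otimes>\<^bsub>K\<^esub> mon_eval K c m)"
  by (simp add: mpoly_eval_def mon_eval_def)

lemma (in cring) mpolys_props:
  assumes "p \<in> mpolys R n"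
  shows "finite {m. p m \<noteq> \<zero>}" "\<And>m. p m \<in> carrier R" "\<And>m. p m \<noteq> \<zero> \<Longrightarrow> set_mset m \<subseteq> {..<n}"
proof -
  have p: "p \<in> indexed_pset {..<n} (carrier R)" using assms by (simp add: mpolys_def)
  show "p m \<in> carrier R" for m
    using indexed_pset_in_carrier[OF _ p] by (auto simp: carrier_coeff_def)
  from p have "finite {m. p m \<noteq> \<zero>} \<and> (\<forall>m. p m \<noteq> \<zero> \<longrightarrow> set_mset m \<subseteq> {..<n})"
  proof induction
    case (indexed_const k)
    have "{m. indexed_const k m \<noteq> \<zero>} \<subseteq> {{#}}" by (auto simp: indexed_const_def)
    thus ?case by (auto intro: finite_subset simp: indexed_const_def)
  next
    case (indexed_padd P Q)
    have "{m. indexed_padd P Q m \<noteq> \<zero>} \<subseteq> {m. P m \<noteq> \<zero>} \<union> {m. Q m \<noteq> \<zero>}"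
      by (auto simp: indexed_padd_def)
    moreover have "finite ({m. P m \<noteq> \<zero>} \<union> {m. Q m \<noteq> \<zero>})" using indexed_padd.IH by simp
    ultimately have "finite {m. indexed_padd P Q m \<noteq> \<zero>}" by (rule finite_subset)
    moreover have "set_mset m \<subseteq> {..<n}" if m: "indexed_padd P Q m \<noteq> \<zero>" for m
    proof -
      have "P m \<noteq> \<zero> \<or> Q m \<noteq> \<zero>" using m by (auto simp: indexed_padd_def)
      thus ?thesis using indexed_padd.IH by blast
    qed
    ultimately show ?case by blast
  next
    case (indexed_pmult P i)
    have "{m. indexed_pmult P i m \<noteq> \<zero>} \<subseteq> add_mset i ` {m. P m \<noteq> \<zero>}"
    proof
      fix m assume "m \<in> {m. indexed_pmult P i m \<noteq> \<zero>}"
      hence "i \<in># m" "P (m - {#i#}) \<noteq> \<zero>" by (auto simp: indexed_pmult_def split: if_splits)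
      thus "m \<in> add_mset i ` {m. P m \<noteq> \<zero>}"
        by (intro image_eqI[of _ _ "m - {#i#}"]) auto
    qed
    note sub = this
    have "finite {m. indexed_pmult P i m \<noteq> \<zero>}"
      by (rule finite_subset[OF sub]) (use indexed_pmult.IH in simp)
    moreover have "set_mset m \<subseteq> {..<n}" if m: "indexed_pmult P i m \<noteq> \<zero>" for m
    proof -
      obtain m' where "m = add_mset i m'" "P m' \<noteq> \<zero>" using sub m by blast
      thus ?thesis using indexed_pmult by simp
    qed
    ultimately show ?case by blast
  qed
  thus "finite {m. p m \<noteq> \<zero>}" "\<And>m. p m \<noteq> \<zero> \<Longrightarrow> set_mset m \<subseteq> {..<n}" by auto
qed

lemma (in cring) mpoly_eval_superset:
  assumes p: "p \<in> mpolys R n" and c: "c \<in> coords R n"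
    and A: "finite A" "{m. p m \<noteq> \<zero>} \<subseteq> A" "\<And>m. m \<in> A \<Longrightarrow> set_mset m \<subseteq> {..<n}"
  shows "mpoly_eval R p c = (\<Oplus>m\<in>A. p m \<otimes> mon_eval R c m)"
proof -
  have me: "mon_eval R c m \<in> carrier R" if "m \<in> A" for m
    using A(3)[OF that] c by (intro mon_eval_closed) (auto simp: coords_def)
  show ?thesis
    unfolding mpoly_eval_mon
    by (rule add.finprod_mono_neutral_cong_left) (use A me mpolys_props[OF p] in auto)
qed

lemma (in cring) mpoly_eval_closed [simp]:
  assumes p: "p \<in> mpolys R n" and c: "c \<in> coords R n"
  shows "mpoly_eval R p c \<in> carrier R"
  unfolding mpoly_eval_mon using mpolys_props[OF p] c
  by (intro finsum_closed Pi_I m_closed mon_eval_closed) (auto simp: coords_def)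

lemma (in cring) mpoly_eval_const:
  assumes "k \<in> carrier R" shows "mpoly_eval R (indexed_const k) c = k"
proof -
  have S: "{m. indexed_const k m \<noteq> \<zero>} = (if k = \<zero> then {} else {{#}})"
    by (auto simp: indexed_const_def)
  show ?thesis using assms unfolding mpoly_eval_mon S by (simp add: indexed_const_def)
qed

lemma (in cring) mpoly_eval_padd:
  assumes p: "p \<in> mpolys R n" and q: "q \<in> mpolys R n" and c: "c \<in> coords R n"
  shows "mpoly_eval R (indexed_padd p q) c = mpoly_eval R p c \<oplus> mpoly_eval R q c"
proof -
  let ?A = "{m. p m \<noteq> \<zero>} \<union> {m. q m \<noteq> \<zero>}"
  note P = mpolys_props[OF p] and Q = mpolys_props[OF q]
  have A: "finite ?A" "\<And>m. m \<in> ?A \<Longrightarrow> set_mset m \<subseteq> {..<n}"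
    using P(1) Q(1) P(3) Q(3) by (simp, blast)
  have pq: "indexed_padd p q \<in> mpolys R n"
    using p q unfolding mpolys_def by (rule indexed_pset.indexed_padd)
  have me: "mon_eval R c m \<in> carrier R" if "m \<in> ?A" for m
    using A(2)[OF that] c by (intro mon_eval_closed) (auto simp: coords_def)
  have "mpoly_eval R (indexed_padd p q) c = (\<Oplus>m\<in>?A. indexed_padd p q m \<otimes> mon_eval R c m)"
    by (rule mpoly_eval_superset[OF pq c A(1) _ A(2)]) (use P(2) Q(2) in \<open>auto simp: indexed_padd_def\<close>)
  also have "\<dots> = (\<Oplus>m\<in>?A. p m \<otimes> mon_eval R c m \<oplus> q m \<otimes> mon_eval R c m)"
    by (rule finsum_cong') (use me P Q in \<open>auto simp: indexed_padd_def l_distr\<close>)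
  also have "\<dots> = (\<Oplus>m\<in>?A. p m \<otimes> mon_eval R c m) \<oplus> (\<Oplus>m\<in>?A. q m \<otimes> mon_eval R c m)"
    by (rule finsum_addf) (use me P Q in auto)
  also have "\<dots> = mpoly_eval R p c \<oplus> mpoly_eval R q c"
    using mpoly_eval_superset[OF p c A(1) _ A(2)] mpoly_eval_superset[OF q c A(1) _ A(2)] by auto
  finally show ?thesis .
qed

lemma (in cring) mpoly_eval_pmult:
  assumes p: "p \<in> mpolys R n" and i: "i < n" and c: "c \<in> coords R n"
  shows "mpoly_eval R (indexed_pmult p i) c = mpoly_eval R p c \<otimes> c i"
proof -
  let ?S = "{m. p m \<noteq> \<zero>}"
  note P = mpolys_props[OF p]
  have ci: "c i \<in> carrier R" using c i by (auto simp: coords_def)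
  have cj: "c j \<in> carrier R" if "m \<in> ?S" "j \<in># m" for m j
    using that P(3) c by (auto simp: coords_def)
  have me: "mon_eval R c m \<in> carrier R" if "m \<in> ?S" for m
    by (rule mon_eval_closed) (use cj that in auto)
  have S: "{m. indexed_pmult p i m \<noteq> \<zero>} = add_mset i ` ?S"
  proof (intro equalityI subsetI)
    fix m assume "m \<in> {m. indexed_pmult p i m \<noteq> \<zero>}"
    hence "i \<in># m" "p (m - {#i#}) \<noteq> \<zero>" by (auto simp: indexed_pmult_def split: if_splits)
    thus "m \<in> add_mset i ` ?S" by (intro image_eqI[of _ _ "m - {#i#}"]) auto
  qed (auto simp: indexed_pmult_def)
  have "mpoly_eval R (indexed_pmult p i) c
      = (\<Oplus>m\<in>add_mset i ` ?S. indexed_pmult p i m \<otimes> mon_eval R c m)"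
    by (simp add: mpoly_eval_mon S)
  also have "\<dots> = (\<Oplus>m\<in>?S. indexed_pmult p i (add_mset i m) \<otimes> mon_eval R c (add_mset i m))"
    by (rule add.finprod_reindex)
      (use P(2) me ci cj in \<open>auto simp: mon_eval_add_mset indexed_pmult_def inj_on_def\<close>)
  also have "\<dots> = (\<Oplus>m\<in>?S. p m \<otimes> mon_eval R c m \<otimes> c i)"
    by (rule finsum_cong')
      (use P(2) me ci cj in \<open>auto simp: mon_eval_add_mset indexed_pmult_def m_assoc\<close>)
  also have "\<dots> = mpoly_eval R p c \<otimes> c i"
    unfolding mpoly_eval_mon by (rule finsum_ldistr[symmetric]) (use P me ci in auto)
  finally show ?thesis .
qed

text \<open>The polynomial functions are closed under products.\<close>

lemma (in cring) mpolys_mult: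
  assumes p: "p \<in> mpolys R n" and q: "q \<in> mpolys R n"
  shows "\<exists>r \<in> mpolys R n. \<forall>c \<in> coords R n. mpoly_eval R r c = mpoly_eval R p c \<otimes> mpoly_eval R q c"
proof -
  have "p \<in> indexed_pset {..<n} (carrier R)" using p by (simp add: mpolys_def)
  thus ?thesis
  proof induction
    case (indexed_const k)
    from q have "q \<in> indexed_pset {..<n} (carrier R)" by (simp add: mpolys_def)
    hence "\<exists>r \<in> mpolys R n. \<forall>c \<in> coords R n. mpoly_eval R r c = k \<otimes> mpoly_eval R q c"
    proof induction
      case (indexed_const l)
      thus ?case using \<open>k \<in> carrier R\<close>
        by (intro bexI[of _ "indexed_const (k \<otimes> l)"])
          (auto simp: mpoly_eval_const mpolys_def intro: indexed_pset.indexed_const)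
    next
      case (indexed_padd P Q)
      then obtain r s where r: "r \<in> mpolys R n" "\<forall>c \<in> coords R n. mpoly_eval R r c = k \<otimes> mpoly_eval R P c"
        and s: "s \<in> mpolys R n" "\<forall>c \<in> coords R n. mpoly_eval R s c = k \<otimes> mpoly_eval R Q c" by blast
      have PQ: "P \<in> mpolys R n" "Q \<in> mpolys R n" using indexed_padd by (auto simp: mpolys_def)
      have "indexed_padd r s \<in> mpolys R n"
        using r(1) s(1) by (auto simp: mpolys_def intro: indexed_pset.indexed_padd)
      thus ?case using r s PQ \<open>k \<in> carrier R\<close>
        by (intro bexI[of _ "indexed_padd r s"]) (auto simp: mpoly_eval_padd r_distr)
    next
      case (indexed_pmult P i)
      then obtain r where r: "r \<in> mpolys R n" "\<forall>c \<in> coords R n. mpoly_eval R r c = k \<otimes> mpoly_eval R P c"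
        by blast
      have P: "P \<in> mpolys R n" and i: "i < n" using indexed_pmult by (auto simp: mpolys_def)
      have c: "c i \<in> carrier R" if "c \<in> coords R n" for c using that i by (auto simp: coords_def)
      have "indexed_pmult r i \<in> mpolys R n"
        using r(1) i by (auto simp: mpolys_def intro: indexed_pset.indexed_pmult)
      thus ?case using r P i c \<open>k \<in> carrier R\<close>
        by (intro bexI[of _ "indexed_pmult r i"]) (auto simp: mpoly_eval_pmult m_assoc)
    qed
    thus ?case using indexed_const by (simp add: mpoly_eval_const)
  next
    case (indexed_padd P Q)
    then obtain r s where r: "r \<in> mpolys R n" "\<forall>c \<in> coords R n. mpoly_eval R r c = mpoly_eval R P c \<otimes> mpoly_eval R q c"
      and s: "s \<in> mpolys R n" "\<forall>c \<in> coords R n. mpoly_eval R s c = mpoly_eval R Q c \<otimes> mpoly_eval R q c" by blast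
    have PQ: "P \<in> mpolys R n" "Q \<in> mpolys R n" using indexed_padd by (auto simp: mpolys_def)
    have "indexed_padd r s \<in> mpolys R n"
      using r(1) s(1) by (auto simp: mpolys_def intro: indexed_pset.indexed_padd)
    thus ?case using r s PQ q
      by (intro bexI[of _ "indexed_padd r s"]) (auto simp: mpoly_eval_padd l_distr)
  next
    case (indexed_pmult P i)
    then obtain r where r: "r \<in> mpolys R n" "\<forall>c \<in> coords R n. mpoly_eval R r c = mpoly_eval R P c \<otimes> mpoly_eval R q c"
      by blast
    have P: "P \<in> mpolys R n" and i: "i < n" using indexed_pmult by (auto simp: mpolys_def)
    have c: "c i \<in> carrier R" if "c \<in> coords R n" for c using that i by (auto simp: coords_def)
    have "indexed_pmult r i \<in> mpolys R n"
      using r(1) i by (auto simp: mpolys_def intro: indexed_pset.indexed_pmult)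
    thus ?case using r P i c q
      by (intro bexI[of _ "indexed_pmult r i"]) (auto simp: mpoly_eval_pmult m_ac)
  qed
qed

lemma coordsI: "(\<And>j. j < n \<Longrightarrow> f j \<in> carrier K) \<Longrightarrow> (\<lambda>j\<in>{..<n}. f j) \<in> coords K n"
  by (auto simp: coords_def)

lemma (in cring) mpolys_subst:
  assumes p: "p \<in> mpolys R n" and q: "\<And>j. j < n \<Longrightarrow> q j \<in> mpolys R k"
  shows "\<exists>r \<in> mpolys R k. \<forall>c \<in> coords R k.
    mpoly_eval R r c = mpoly_eval R p (\<lambda>j\<in>{..<n}. mpoly_eval R (q j) c)"
proof -
  define E where "E = (\<lambda>c. \<lambda>j\<in>{..<n}. mpoly_eval R (q j) c)"
  have Ej: "E c j = mpoly_eval R (q j) c" if "j < n" for c j using that by (simp add: E_def)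
  have e: "E c \<in> coords R n" if "c \<in> coords R k" for c
    unfolding E_def using that q by (intro coordsI mpoly_eval_closed) auto
  have "p \<in> indexed_pset {..<n} (carrier R)" using p by (simp add: mpolys_def)
  hence "\<exists>r \<in> mpolys R k. \<forall>c \<in> coords R k. mpoly_eval R r c = mpoly_eval R p (E c)"
  proof induction
    case (indexed_const l)
    thus ?case
      by (intro bexI[of _ "indexed_const l"])
        (auto simp: mpoly_eval_const mpolys_def intro: indexed_pset.indexed_const)
  next
    case (indexed_padd P Q)
    then obtain r s where r: "r \<in> mpolys R k" "\<forall>c \<in> coords R k. mpoly_eval R r c = mpoly_eval R P (E c)"
      and s: "s \<in> mpolys R k" "\<forall>c \<in> coords R k. mpoly_eval R s c = mpoly_eval R Q (E c)" by blast
    have PQ: "P \<in> mpolys R n" "Q \<in> mpolys R n" using indexed_padd by (auto simp: mpolys_def)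
    have "indexed_padd r s \<in> mpolys R k"
      using r(1) s(1) by (auto simp: mpolys_def intro: indexed_pset.indexed_padd)
    thus ?case using r s PQ e
      by (intro bexI[of _ "indexed_padd r s"]) (auto simp: mpoly_eval_padd)
  next
    case (indexed_pmult P i)
    then obtain r where r: "r \<in> mpolys R k" "\<forall>c \<in> coords R k. mpoly_eval R r c = mpoly_eval R P (E c)"
      by blast
    have P: "P \<in> mpolys R n" and i: "i < n" using indexed_pmult by (auto simp: mpolys_def)
    obtain s where "s \<in> mpolys R k"
      "\<forall>c \<in> coords R k. mpoly_eval R s c = mpoly_eval R r c \<otimes> mpoly_eval R (q i) c"
      using mpolys_mult[OF r(1) q[OF i]] by blast
    thus ?case using r P i e by (intro bexI[of _ s]) (auto simp: mpoly_eval_pmult Ej)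
  qed
  thus ?thesis by (simp only: E_def)
qed

subsection \<open>Coordinates\<close>

context Module.module
begin

lemma lin_comb_closed [simp]:
  assumes "set bs \<subseteq> carrier M" "c \<in> coords R (length bs)"
  shows "lin_comb M bs c \<in> carrier M"
  unfolding lin_comb_def
  by (rule M.finsum_closed) (use assms in \<open>auto simp: coords_def intro!: smult_closed\<close>)

lemma lin_comb_add:
  assumes "set bs \<subseteq> carrier M" "c \<in> coords R (length bs)" "d \<in> coords R (length bs)"
  shows "lin_comb M bs c \<oplus>\<^bsub>M\<^esub> lin_comb M bs d = lin_comb M bs (\<lambda>i\<in>{..<length bs}. c i \<oplus> d i)"
proof -
  have cl: "c i \<in> carrier R" "d i \<in> carrier R" "bs ! i \<in> carrier M" if "i < length bs" for i
    using assms that by (auto simp: coords_def)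
  have "lin_comb M bs (\<lambda>i\<in>{..<length bs}. c i \<oplus> d i)
    = (\<Oplus>\<^bsub>M\<^esub>i\<in>{..<length bs}. c i \<odot>\<^bsub>M\<^esub> (bs ! i) \<oplus>\<^bsub>M\<^esub> d i \<odot>\<^bsub>M\<^esub> (bs ! i))"
    unfolding lin_comb_def by (rule M.finsum_cong') (use cl in \<open>auto simp: smult_l_distr\<close>)
  also have "\<dots> = lin_comb M bs c \<oplus>\<^bsub>M\<^esub> lin_comb M bs d"
    unfolding lin_comb_def by (rule M.finsum_addf) (use cl in auto)
  finally show ?thesis ..
qed

lemma lin_comb_smult:
  assumes "set bs \<subseteq> carrier M" "c \<in> coords R (length bs)" "a \<in> carrier R"
  shows "a \<odot>\<^bsub>M\<^esub> lin_comb M bs c = lin_comb M bs (\<lambda>i\<in>{..<length bs}. a \<otimes> c i)"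
proof -
  have cl: "c i \<in> carrier R" "bs ! i \<in> carrier M" if "i < length bs" for i
    using assms that by (auto simp: coords_def)
  have "a \<odot>\<^bsub>M\<^esub> lin_comb M bs c = (\<Oplus>\<^bsub>M\<^esub>i\<in>{..<length bs}. a \<odot>\<^bsub>M\<^esub> (c i \<odot>\<^bsub>M\<^esub> (bs ! i)))"
    unfolding lin_comb_def by (rule finsum_smult_ldistr) (use cl assms(3) in auto)
  also have "\<dots> = lin_comb M bs (\<lambda>i\<in>{..<length bs}. a \<otimes> c i)"
    unfolding lin_comb_def by (rule M.finsum_cong') (use cl assms(3) in \<open>auto simp: smult_assoc1\<close>)
  finally show ?thesis .
qed

lemma basis_bij_betw:
  assumes "is_basis R M bs"
  shows "bij_betw (lin_comb M bs) (coords R (length bs)) (carrier M)"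
proof -
  let ?n = "length bs"
  have bs: "set bs \<subseteq> carrier M" using assms by (simp add: is_basis_def)
  have "inj_on (lin_comb M bs) (coords R ?n)"
  proof (rule inj_onI)
    fix c d assume c: "c \<in> coords R ?n" and d: "d \<in> coords R ?n"
      and eq: "lin_comb M bs c = lin_comb M bs d"
    have cd: "c i \<in> carrier R" "d i \<in> carrier R" if "i < ?n" for i
      using that c d by (auto simp: coords_def)
    define e where "e = (\<lambda>i\<in>{..<?n}. c i \<ominus> d i)"
    have e: "e \<in> coords R ?n" using cd by (auto simp: coords_def e_def)
    have "(\<lambda>i\<in>{..<?n}. e i \<oplus> d i) = c"
    proof
      fix i show "(\<lambda>i\<in>{..<?n}. e i \<oplus> d i) i = c i"
        using cd[of i] c
        by (auto simp: e_def coords_def PiE_def extensional_def R.minus_eq R.a_assoc R.l_neg)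
    qed
    hence "lin_comb M bs e \<oplus>\<^bsub>M\<^esub> lin_comb M bs d = lin_comb M bs d"
      using lin_comb_add[OF bs e d] eq by simp
    hence "lin_comb M bs e = \<zero>\<^bsub>M\<^esub>"
      using lin_comb_closed[OF bs e] lin_comb_closed[OF bs d] M.add.r_cancel_one by auto
    hence z: "\<forall>i<?n. e i = \<zero>" using assms e by (auto simp: is_basis_def)
    show "c = d"
    proof
      fix i show "c i = d i"
      proof (cases "i < ?n")
        case True
        hence "c i \<ominus> d i = \<zero>" using z by (simp add: e_def)
        thus ?thesis using cd[OF True] by simp
      next
        case False
        thus ?thesis using c d by (auto simp: coords_def PiE_def extensional_def)
      qed
    qed
  qed
  moreover have "lin_comb M bs ` coords R ?n = carrier M"
    using assms lin_comb_closed[OF bs] unfolding is_basis_def by blast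
  ultimately show ?thesis by (simp add: bij_betw_def)
qed

lemma zariski_closed_change_basis:
  assumes b: "is_basis R M bs" and b': "is_basis R M bs'" and Z: "zariski_closed R M bs Z"
  shows "zariski_closed R M bs' Z"
proof -
  let ?n = "length bs" and ?k = "length bs'"
  have bs: "set bs \<subseteq> carrier M" "set bs' \<subseteq> carrier M" using b b' by (auto simp: is_basis_def)
  have "\<exists>q. (\<forall>j<?n. q j \<in> mpolys R ?k) \<and> (\<forall>c\<in>coords R ?k.
      (\<Oplus>\<^bsub>M\<^esub>i\<in>{..<m}. c i \<odot>\<^bsub>M\<^esub> (bs' ! i)) = lin_comb M bs (\<lambda>j\<in>{..<?n}. mpoly_eval R (q j) c))"
    if "m \<le> ?k" for m
    using that
  proof (induction m)
    case 0
    have "lin_comb M bs (\<lambda>j\<in>{..<?n}. \<zero>) = (\<Oplus>\<^bsub>M\<^esub>i\<in>{..<?n}. \<zero>\<^bsub>M\<^esub>)"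
      unfolding lin_comb_def by (rule M.finsum_cong') (use nth_mem[of _ bs] bs in \<open>auto intro!: smult_l_null\<close>)
    thus ?case
      by (intro exI[of _ "\<lambda>_. indexed_const \<zero>"])
        (auto simp: mpolys_def mpoly_eval_const restrict_def intro: indexed_pset.indexed_const)
  next
    case (Suc m)
    then obtain q where q: "\<And>j. j < ?n \<Longrightarrow> q j \<in> mpolys R ?k"
      and qe: "\<And>c. c \<in> coords R ?k \<Longrightarrow> (\<Oplus>\<^bsub>M\<^esub>i\<in>{..<m}. c i \<odot>\<^bsub>M\<^esub> (bs' ! i))
        = lin_comb M bs (\<lambda>j\<in>{..<?n}. mpoly_eval R (q j) c)"
      by (metis Suc_leD)
    have m: "m < ?k" using Suc by simp
    have "bs' ! m \<in> carrier M" using bs m by auto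
    then obtain a where a: "a \<in> coords R ?n" "bs' ! m = lin_comb M bs a"
      using b unfolding is_basis_def by blast
    have aj: "a j \<in> carrier R" if "j < ?n" for j using a that by (auto simp: coords_def)
    define r where "r = (\<lambda>j. indexed_padd (q j) (indexed_pmult (indexed_const (a j)) m))"
    have t: "indexed_const (a j) \<in> mpolys R ?k" "indexed_pmult (indexed_const (a j)) m \<in> mpolys R ?k"
      if "j < ?n" for j
      using aj[OF that] m
      by (auto simp: mpolys_def intro!: indexed_pset.indexed_const indexed_pset.indexed_pmult)
    have r: "r j \<in> mpolys R ?k" if "j < ?n" for j
      using q[OF that] t[OF that] by (auto simp: r_def mpolys_def intro: indexed_pset.indexed_padd)
    have "(\<Oplus>\<^bsub>M\<^esub>i\<in>{..<Suc m}. c i \<odot>\<^bsub>M\<^esub> (bs' ! i)) = lin_comb M bs (\<lambda>j\<in>{..<?n}. mpoly_eval R (r j) c)"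
      if c: "c \<in> coords R ?k" for c
    proof -
      have ci: "c i \<in> carrier R" "bs' ! i \<in> carrier M" if "i < ?k" for i
        using c bs that by (auto simp: coords_def)
      have q': "(\<lambda>j\<in>{..<?n}. mpoly_eval R (q j) c) \<in> coords R ?n"
        using q c by (intro coordsI mpoly_eval_closed) auto
      have a': "(\<lambda>j\<in>{..<?n}. c m \<otimes> a j) \<in> coords R ?n"
        using ci m aj by (auto simp: coords_def)
      have "(\<Oplus>\<^bsub>M\<^esub>i\<in>{..<Suc m}. c i \<odot>\<^bsub>M\<^esub> (bs' ! i))
          = c m \<odot>\<^bsub>M\<^esub> (bs' ! m) \<oplus>\<^bsub>M\<^esub> (\<Oplus>\<^bsub>M\<^esub>i\<in>{..<m}. c i \<odot>\<^bsub>M\<^esub> (bs' ! i))"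
        unfolding lessThan_Suc by (rule M.finsum_insert) (use ci m in auto)
      also have "\<dots> = lin_comb M bs (\<lambda>j\<in>{..<?n}. c m \<otimes> a j)
          \<oplus>\<^bsub>M\<^esub> lin_comb M bs (\<lambda>j\<in>{..<?n}. mpoly_eval R (q j) c)"
        using qe[OF c] a lin_comb_smult[OF bs(1) a(1)] ci m by simp
      also have "\<dots> = lin_comb M bs (\<lambda>j\<in>{..<?n}. c m \<otimes> a j \<oplus> mpoly_eval R (q j) c)"
        using lin_comb_add[OF bs(1) a' q'] by (simp cong: restrict_cong)
      also have "(\<lambda>j\<in>{..<?n}. c m \<otimes> a j \<oplus> mpoly_eval R (q j) c) = (\<lambda>j\<in>{..<?n}. mpoly_eval R (r j) c)"
      proof (rule restrict_ext)
        fix j assume "j \<in> {..<?n}"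
        hence j: "j < ?n" by simp
        show "c m \<otimes> a j \<oplus> mpoly_eval R (q j) c = mpoly_eval R (r j) c"
          unfolding r_def
          using mpoly_eval_padd[OF q[OF j] t(2)[OF j] c] mpoly_eval_pmult[OF t(1)[OF j] m c]
            aj[OF j] ci[OF m] mpoly_eval_closed[OF q[OF j] c]
          by (simp add: mpoly_eval_const R.m_comm R.a_comm)
      qed
      finally show ?thesis .
    qed
    thus ?case using r by blast
  qed
  from this[of ?k] obtain q where q: "\<And>j. j < ?n \<Longrightarrow> q j \<in> mpolys R ?k"
    and qe: "\<And>c. c \<in> coords R ?k \<Longrightarrow>
      lin_comb M bs' c = lin_comb M bs (\<lambda>j\<in>{..<?n}. mpoly_eval R (q j) c)"
    unfolding lin_comb_def[of M bs'] by blast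
  let ?e = "\<lambda>c. \<lambda>j\<in>{..<?n}. mpoly_eval R (q j) c"
  have e: "?e c \<in> coords R ?n" if "c \<in> coords R ?k" for c
    using that q by (intro coordsI mpoly_eval_closed) auto
  obtain F where F: "F \<subseteq> mpolys R ?n" "Z = lin_comb M bs ` zero_set R ?n F"
    using Z by (auto simp: zariski_closed_def)
  define G where "G = {r \<in> mpolys R ?k. \<exists>p\<in>F. \<forall>c\<in>coords R ?k. mpoly_eval R r c = mpoly_eval R p (?e c)}"
  have zG: "c \<in> zero_set R ?k G \<longleftrightarrow> ?e c \<in> zero_set R ?n F" if c: "c \<in> coords R ?k" for c
  proof
    assume L: "c \<in> zero_set R ?k G"
    have "mpoly_eval R p (?e c) = \<zero>" if "p \<in> F" for p
    proof -
      obtain r where r: "r \<in> mpolys R ?k" "\<forall>c\<in>coords R ?k. mpoly_eval R r c = mpoly_eval R p (?e c)"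
        using mpolys_subst[of p ?n q ?k] F q \<open>p \<in> F\<close> by blast
      hence "r \<in> G" using \<open>p \<in> F\<close> by (auto simp: G_def)
      thus ?thesis using L r c by (auto simp: zero_set_def)
    qed
    thus "?e c \<in> zero_set R ?n F" using e[OF c] by (auto simp: zero_set_def)
  next
    assume "?e c \<in> zero_set R ?n F"
    thus "c \<in> zero_set R ?k G" using c by (auto simp: zero_set_def G_def)
  qed
  have "lin_comb M bs ` zero_set R ?n F = lin_comb M bs' ` zero_set R ?k G"
  proof (intro equalityI subsetI)
    fix v assume "v \<in> lin_comb M bs ` zero_set R ?n F"
    then obtain d where d: "d \<in> zero_set R ?n F" "v = lin_comb M bs d" by blast
    hence dc: "d \<in> coords R ?n" by (simp add: zero_set_def)
    hence "v \<in> carrier M" using d lin_comb_closed[OF bs(1)] by simp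
    then obtain c where c: "c \<in> coords R ?k" "v = lin_comb M bs' c"
      using b' unfolding is_basis_def by blast
    hence "?e c = d"
      using basis_bij_betw[OF b] qe[OF c(1)] e[OF c(1)] d dc by (auto simp: bij_betw_def dest: inj_onD)
    thus "v \<in> lin_comb M bs' ` zero_set R ?k G" using zG[OF c(1)] c d by auto
  next
    fix v assume "v \<in> lin_comb M bs' ` zero_set R ?k G"
    then obtain c where c: "c \<in> zero_set R ?k G" "v = lin_comb M bs' c" by blast
    hence cc: "c \<in> coords R ?k" by (simp add: zero_set_def)
    thus "v \<in> lin_comb M bs ` zero_set R ?n F" using zG[OF cc] c qe[OF cc] by auto
  qed
  moreover have "G \<subseteq> mpolys R ?k" by (auto simp: G_def)
  ultimately show ?thesis using F by (auto simp: zariski_closed_def)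
qed

subsection \<open>The families of open sets are topologies\<close>

lemma zariski_closed_Un:
  assumes K: "domain R" and Y: "zariski_closed R M bs Y" and Z: "zariski_closed R M bs Z"
  shows "zariski_closed R M bs (Y \<union> Z)"
proof -
  let ?n = "length bs"
  interpret domain R by fact
  obtain F where F: "F \<subseteq> mpolys R ?n" "Y = lin_comb M bs ` zero_set R ?n F"
    using Y by (auto simp: zariski_closed_def)
  obtain G where G: "G \<subseteq> mpolys R ?n" "Z = lin_comb M bs ` zero_set R ?n G"
    using Z by (auto simp: zariski_closed_def)
  define H where "H = {r \<in> mpolys R ?n. \<exists>p\<in>F. \<exists>q\<in>G. \<forall>c\<in>coords R ?n.
    mpoly_eval R r c = mpoly_eval R p c \<otimes> mpoly_eval R q c}"
  have "zero_set R ?n H = zero_set R ?n F \<union> zero_set R ?n G"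
  proof (intro equalityI subsetI)
    fix c assume c: "c \<in> zero_set R ?n H"
    hence cc: "c \<in> coords R ?n" by (simp add: zero_set_def)
    show "c \<in> zero_set R ?n F \<union> zero_set R ?n G"
    proof (rule ccontr)
      assume "\<not> ?thesis"
      then obtain p q where pq: "p \<in> F" "q \<in> G" "mpoly_eval R p c \<noteq> \<zero>" "mpoly_eval R q c \<noteq> \<zero>"
        using cc by (auto simp: zero_set_def)
      hence pm: "p \<in> mpolys R ?n" "q \<in> mpolys R ?n" using F G by auto
      then obtain r where r: "r \<in> mpolys R ?n"
        "\<forall>c\<in>coords R ?n. mpoly_eval R r c = mpoly_eval R p c \<otimes> mpoly_eval R q c"
        using mpolys_mult by blast
      hence "r \<in> H" using pq by (auto simp: H_def)
      hence "mpoly_eval R p c \<otimes> mpoly_eval R q c = \<zero>" using c r cc by (auto simp: zero_set_def)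
      thus False using integral pq mpoly_eval_closed[OF pm(1) cc] mpoly_eval_closed[OF pm(2) cc] by blast
    qed
  next
    fix c assume "c \<in> zero_set R ?n F \<union> zero_set R ?n G"
    thus "c \<in> zero_set R ?n H"
    proof
      assume c: "c \<in> zero_set R ?n F"
      have "mpoly_eval R r c = \<zero>" if rH: "r \<in> H" for r
      proof -
        obtain p q where "p \<in> F" "q \<in> G" "mpoly_eval R r c = mpoly_eval R p c \<otimes> mpoly_eval R q c"
          using rH c by (auto simp: H_def zero_set_def)
        thus ?thesis using c G mpoly_eval_closed[of q ?n c] by (auto simp: zero_set_def)
      qed
      thus ?thesis using c by (simp add: zero_set_def)
    next
      assume c: "c \<in> zero_set R ?n G"
      have "mpoly_eval R r c = \<zero>" if rH: "r \<in> H" for r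
      proof -
        obtain p q where "p \<in> F" "q \<in> G" "mpoly_eval R r c = mpoly_eval R p c \<otimes> mpoly_eval R q c"
          using rH c by (auto simp: H_def zero_set_def)
        thus ?thesis using c F mpoly_eval_closed[of p ?n c] by (auto simp: zero_set_def)
      qed
      thus ?thesis using c by (simp add: zero_set_def)
    qed
  qed
  moreover have "H \<subseteq> mpolys R ?n" by (auto simp: H_def)
  ultimately show ?thesis using F G unfolding zariski_closed_def by (metis image_Un)
qed

lemma zariski_closed_Inter:
  assumes b: "is_basis R M bs" and Z: "\<And>Z. Z \<in> \<Z> \<Longrightarrow> zariski_closed R M bs Z"
  shows "zariski_closed R M bs (carrier M \<inter> \<Inter> \<Z>)"
proof -
  let ?n = "length bs" and ?L = "lin_comb M bs"
  from Z obtain F where F: "\<And>Z. Z \<in> \<Z> \<Longrightarrow> F Z \<subseteq> mpolys R ?n \<and> Z = ?L ` zero_set R ?n (F Z)"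
    unfolding zariski_closed_def by metis
  have bij: "inj_on ?L (coords R ?n)" "?L ` coords R ?n = carrier M"
    using basis_bij_betw[OF b] by (auto simp: bij_betw_def)
  have "carrier M \<inter> \<Inter> \<Z> = ?L ` zero_set R ?n (\<Union> (F ` \<Z>))"
  proof (intro equalityI subsetI)
    fix v assume v: "v \<in> carrier M \<inter> \<Inter> \<Z>"
    then obtain c where c: "c \<in> coords R ?n" "v = ?L c" using bij by blast
    have "c \<in> zero_set R ?n (F Z)" if ZZ: "Z \<in> \<Z>" for Z
    proof -
      obtain d where d: "d \<in> zero_set R ?n (F Z)" "v = ?L d" using v F[OF ZZ] ZZ by blast
      hence "d = c" using c bij(1) by (auto simp: zero_set_def dest: inj_onD)
      thus ?thesis using d by simp
    qed
    thus "v \<in> ?L ` zero_set R ?n (\<Union> (F ` \<Z>))" using c by (auto simp: zero_set_def)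
  next
    fix v assume "v \<in> ?L ` zero_set R ?n (\<Union> (F ` \<Z>))"
    then obtain c where c: "c \<in> zero_set R ?n (\<Union> (F ` \<Z>))" "v = ?L c" by blast
    have "v \<in> Z" if "Z \<in> \<Z>" for Z
    proof -
      have "c \<in> zero_set R ?n (F Z)" using c that by (auto simp: zero_set_def)
      thus ?thesis using F[OF that] c by blast
    qed
    moreover have "v \<in> carrier M" using c bij by (auto simp: zero_set_def)
    ultimately show "v \<in> carrier M \<inter> \<Inter> \<Z>" by blast
  qed
  thus ?thesis using F unfolding zariski_closed_def by (intro exI[of _ "\<Union> (F ` \<Z>)"]) blast
qed

lemma istopology_zariski:
  assumes K: "domain R" and b: "is_basis R M bs"
  shows "istopology (\<lambda>U. U \<subseteq> carrier M \<and> zariski_closed R M bs (carrier M - U))"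
  unfolding istopology_def
proof (intro conjI allI impI)
  fix S T assume "S \<subseteq> carrier M \<and> zariski_closed R M bs (carrier M - S)"
    and "T \<subseteq> carrier M \<and> zariski_closed R M bs (carrier M - T)"
  thus "zariski_closed R M bs (carrier M - S \<inter> T)" "S \<inter> T \<subseteq> carrier M"
    using zariski_closed_Un[OF K] by (auto simp: Diff_Int)
next
  fix \<U> assume U: "\<forall>U\<in>\<U>. U \<subseteq> carrier M \<and> zariski_closed R M bs (carrier M - U)"
  have "carrier M - \<Union> \<U> = carrier M \<inter> \<Inter> ((\<lambda>U. carrier M - U) ` \<U>)" by auto
  moreover have "zariski_closed R M bs (carrier M \<inter> \<Inter> ((\<lambda>U. carrier M - U) ` \<U>))"
    by (rule zariski_closed_Inter[OF b]) (use U in auto)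
  ultimately show "zariski_closed R M bs (carrier M - \<Union> \<U>)" by simp
  show "\<Union> \<U> \<subseteq> carrier M" using U by blast
qed

lemma closedin_zariski_topology:
  assumes K: "domain R" and b: "is_basis R M bs"
  shows "topspace (zariski_topology R M) = carrier M"
    and "closedin (zariski_topology R M) Z \<longleftrightarrow> zariski_closed R M bs Z"
proof -
  let ?b = "some_basis R M"
  have sb: "is_basis R M ?b" unfolding some_basis_def using b by (rule someI)
  have o: "openin (zariski_topology R M) U \<longleftrightarrow>
      U \<subseteq> carrier M \<and> zariski_closed R M ?b (carrier M - U)" for U
    unfolding zariski_topology_def topology_inverse'[OF istopology_zariski[OF K sb]] ..
  have sub: "Z \<subseteq> carrier M" if "zariski_closed R M ?b Z" for Z
    using that basis_bij_betw[OF sb]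
    by (auto simp: zariski_closed_def bij_betw_def zero_set_def)
  have "indexed_const \<one> \<in> mpolys R (length ?b)"
    by (auto simp: mpolys_def intro: indexed_pset.indexed_const)
  moreover have "zero_set R (length ?b) {indexed_const \<one>} = {}"
    using domain.one_not_zero[OF K] by (auto simp: zero_set_def mpoly_eval_const)
  ultimately have "zariski_closed R M ?b {}"
    unfolding zariski_closed_def by (intro exI[of _ "{indexed_const \<one>}"]) auto
  hence "openin (zariski_topology R M) (carrier M)" by (simp add: o)
  thus ts: "topspace (zariski_topology R M) = carrier M"
    by (metis o openin_subset openin_topspace subset_antisym)
  have "closedin (zariski_topology R M) Z \<longleftrightarrow> zariski_closed R M ?b Z"
    using sub[of Z] by (auto simp: closedin_def ts o double_diff)
  also have "\<dots> \<longleftrightarrow> zariski_closed R M bs Z"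
    using zariski_closed_change_basis[OF sb b] zariski_closed_change_basis[OF b sb] by blast
  finally show "closedin (zariski_topology R M) Z \<longleftrightarrow> zariski_closed R M bs Z" .
qed

end

lemma closedin_three_set_topology:
  assumes "\<zero>\<^bsub>V\<^esub> \<in> carrier V"
  shows "topspace (three_set_topology V) = carrier V"
    and "closedin (three_set_topology V) Z \<longleftrightarrow> Z \<in> {{}, {\<zero>\<^bsub>V\<^esub>}, carrier V}"
proof -
  let ?P = "\<lambda>U. U \<subseteq> carrier V \<and> carrier V - U \<in> {{}, {\<zero>\<^bsub>V\<^esub>}, carrier V}"
  have P: "?P U \<longleftrightarrow> U \<in> {{}, carrier V - {\<zero>\<^bsub>V\<^esub>}, carrier V}" for U using assms by auto
  have "istopology (\<lambda>U. U \<in> {{}, carrier V - {\<zero>\<^bsub>V\<^esub>}, carrier V})"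
    unfolding istopology_def
  proof (intro conjI allI impI)
    fix \<U> assume "\<forall>U\<in>\<U>. U \<in> {{}, carrier V - {\<zero>\<^bsub>V\<^esub>}, carrier V}"
    hence U: "\<U> \<subseteq> {{}, carrier V - {\<zero>\<^bsub>V\<^esub>}, carrier V}" by blast
    show "\<Union> \<U> \<in> {{}, carrier V - {\<zero>\<^bsub>V\<^esub>}, carrier V}"
    proof (cases "carrier V \<in> \<U>")
      case True
      hence "\<Union> \<U> = carrier V" using U by blast
      thus ?thesis by simp
    next
      case False
      hence "\<Union> \<U> = carrier V - {\<zero>\<^bsub>V\<^esub>} \<or> \<Union> \<U> = {}" using U by blast
      thus ?thesis by blast
    qed
  qed blast
  hence o: "openin (three_set_topology V) U \<longleftrightarrow> ?P U" for U
    unfolding three_set_topology_def P by (simp add: topology_inverse')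
  have "openin (three_set_topology V) (carrier V)" by (simp add: o)
  thus ts: "topspace (three_set_topology V) = carrier V"
    by (metis o openin_subset openin_topspace subset_antisym)
  show "closedin (three_set_topology V) Z \<longleftrightarrow> Z \<in> {{}, {\<zero>\<^bsub>V\<^esub>}, carrier V}"
    using assms by (auto simp: closedin_def ts o double_diff)
qed

end

theory Submission
  imports Defs "HOL-Algebra.Polynomial_Divisibility"
begin

text \<open>
  All conditions are equivalent to the existence of a maximal ideal \<open>I\<close> for which \<open>M/IM\<close> has dimension
  at least 2 and the residue field \<open>R/I\<close> is finite. The proof is a circle of implications.

  If \<open>M\<close> is a finite union of proper submodules, then, \<open>M\<close> being finitely generated, each of them lies in
  a maximal submodule \<open>P\<close>. The simple module \<open>M/P\<close> is killed by a maximal ideal \<open>I\<close>, so \<open>P\<close> is the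
  preimage of a hyperplane of \<open>M/IM\<close>, which is closed: it is the zero set of a linear form, or it is
  \<open>{0}\<close> when the dimension is 1 (\<open>maximal_submodule_closed\<close>). Hence \<open>M\<close> is a finite union of proper
  closed sets.

  If \<open>M\<close> is a finite union of proper closed sets, then it is reducible, by a purely topological
  induction (\<open>finite_closed_cover_imp_reducible\<close>).

  If no maximal ideal as above exists, then every fibre \<open>M/IM\<close> is irreducible: the three-set topology
  is irreducible by inspection, and affine space over an infinite field is irreducible because two
  nonzero polynomial functions, restricted to a suitable line, have only finitely many zeros. A basic
  open subset of \<open>M\<close> involves only finitely many fibres, and by the Chinese remainder theorem \<open>M\<close> maps
  onto the product of finitely many fibres. So any two nonempty open subsets of \<open>M\<close> meet
  (\<open>induced_zariski_irreducible\<close>). Thus reducibility yields such a maximal ideal.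

  Given such a maximal ideal \<open>I\<close>, the finite vector space \<open>M/IM\<close> is the union of its finitely many
  cyclic subspaces, which are proper since the dimension is at least 2, and their preimages cover \<open>M\<close>
  (\<open>finite_residue_field_imp_submodule_cover\<close>).

  The statements about cardinals follow because a family of proper subsets needs at least two members
  to cover the nonempty set \<open>M\<close>.
\<close>

section \<open>Submodules, spans and bases\<close>

context Module.module
begin

lemma submodule_zero: "submodule N R M \<Longrightarrow> \<zero>\<^bsub>M\<^esub> \<in> N"
  by (auto simp: submodule_def dest: subgroup.one_closed)

lemma submodule_finsum:
  assumes N: "submodule N R M" and A: "finite A" and f: "\<And>i. i \<in> A \<Longrightarrow> f i \<in> N"
  shows "finsum M f A \<in> N"
  using A f
proof (induction A rule: finite_induct)
  case empty
  thus ?case using submodule_zero[OF N] by simp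
next
  case (insert i A)
  have "f \<in> A \<rightarrow> carrier M" "f i \<in> carrier M" using insert submoduleE(1)[OF N] by auto
  thus ?case using insert submoduleE(5)[OF N] by simp
qed

lemma module_span_least: "submodule N R M \<Longrightarrow> A \<subseteq> N \<Longrightarrow> module_span R M A \<subseteq> N"
  unfolding module_span_def by blast

lemma module_span_superset: "A \<subseteq> module_span R M A"
  unfolding module_span_def by blast

lemma lin_comb_in_submodule:
  assumes N: "submodule N R M" and bs: "set bs \<subseteq> N" and c: "c \<in> coords R (length bs)"
  shows "lin_comb M bs c \<in> N"
  unfolding lin_comb_def
proof (rule submodule_finsum[OF N])
  fix i assume "i \<in> {..<length bs}"
  hence "c i \<in> carrier R" "bs ! i \<in> N" using bs c by (auto simp: coords_def)
  thus "c i \<odot>\<^bsub>M\<^esub> (bs ! i) \<in> N" by (rule submoduleE(4)[OF N])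
qed simp

lemma lin_comb_unit:
  assumes bs: "set bs \<subseteq> carrier M" and i: "i < length bs"
  shows "lin_comb M bs (\<lambda>j\<in>{..<length bs}. if j = i then \<one> else \<zero>) = bs ! i"
proof -
  have cl: "bs ! j \<in> carrier M" if "j < length bs" for j using bs that by auto
  have "lin_comb M bs (\<lambda>j\<in>{..<length bs}. if j = i then \<one> else \<zero>)
      = (\<Oplus>\<^bsub>M\<^esub>j\<in>{..<length bs}. if i = j then bs ! j else \<zero>\<^bsub>M\<^esub>)"
    unfolding lin_comb_def by (rule M.finsum_cong') (use cl in \<open>auto intro!: smult_l_null\<close>)
  also have "\<dots> = bs ! i"
    by (rule M.add.finprod_singleton) (use i cl in auto)
  finally show ?thesis .
qed

text \<open>The linear combinations of the generators form a submodule that contains them.\<close>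

lemma module_span_lin_comb:
  assumes bs: "set bs \<subseteq> carrier M" and v: "v \<in> module_span R M (set bs)"
  shows "\<exists>c\<in>coords R (length bs). v = lin_comb M bs c"
proof -
  let ?n = "length bs"
  let ?L = "lin_comb M bs ` coords R ?n"
  have "submodule ?L R M"
  proof (rule submoduleI)
    show "?L \<subseteq> carrier M" using lin_comb_closed[OF bs] by blast
    have z: "(\<lambda>i\<in>{..<?n}. \<zero>) \<in> coords R ?n" by (rule coordsI) simp
    have "\<zero>\<^bsub>M\<^esub> = \<zero> \<odot>\<^bsub>M\<^esub> lin_comb M bs (\<lambda>i\<in>{..<?n}. \<zero>)"
      using lin_comb_closed[OF bs z] by (simp add: smult_l_null)
    also have "\<dots> = lin_comb M bs (\<lambda>i\<in>{..<?n}. \<zero> \<otimes> (\<lambda>i\<in>{..<?n}. \<zero>) i)"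
      by (rule lin_comb_smult[OF bs z]) simp
    also have "\<dots> \<in> ?L" by (intro imageI coordsI) simp
    finally show "\<zero>\<^bsub>M\<^esub> \<in> ?L" .
    show sm: "a \<odot>\<^bsub>M\<^esub> x \<in> ?L" if a: "a \<in> carrier R" and x: "x \<in> ?L" for a x
    proof -
      obtain c where c: "c \<in> coords R ?n" "x = lin_comb M bs c" using x by blast
      have "a \<odot>\<^bsub>M\<^esub> x = lin_comb M bs (\<lambda>i\<in>{..<?n}. a \<otimes> c i)"
        unfolding c(2) by (rule lin_comb_smult[OF bs c(1) a])
      moreover have "(\<lambda>i\<in>{..<?n}. a \<otimes> c i) \<in> coords R ?n"
        using a c(1) by (intro coordsI) (auto simp: coords_def)
      ultimately show ?thesis by blast
    qed
    show "\<ominus>\<^bsub>M\<^esub> x \<in> ?L" if x: "x \<in> ?L" for x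
    proof -
      have "x \<in> carrier M" using x lin_comb_closed[OF bs] by blast
      hence "\<ominus>\<^bsub>M\<^esub> x = (\<ominus> \<one>) \<odot>\<^bsub>M\<^esub> x" by (simp add: smult_l_minus)
      thus ?thesis using sm[of "\<ominus> \<one>" x] x by simp
    qed
    show "x \<oplus>\<^bsub>M\<^esub> y \<in> ?L" if x: "x \<in> ?L" and y: "y \<in> ?L" for x y
    proof -
      obtain c d where c: "c \<in> coords R ?n" "x = lin_comb M bs c"
        and d: "d \<in> coords R ?n" "y = lin_comb M bs d" using x y by blast
      have "x \<oplus>\<^bsub>M\<^esub> y = lin_comb M bs (\<lambda>i\<in>{..<?n}. c i \<oplus> d i)"
        unfolding c(2) d(2) by (rule lin_comb_add[OF bs c(1) d(1)])
      moreover have "(\<lambda>i\<in>{..<?n}. c i \<oplus> d i) \<in> coords R ?n"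
        using c(1) d(1) by (intro coordsI) (auto simp: coords_def)
      ultimately show ?thesis by blast
    qed
  qed
  moreover have "set bs \<subseteq> ?L"
  proof
    fix x assume "x \<in> set bs"
    then obtain i where i: "i < ?n" "x = bs ! i" by (auto simp: in_set_conv_nth)
    have "(\<lambda>j\<in>{..<?n}. if j = i then \<one> else \<zero>) \<in> coords R ?n" by (rule coordsI) simp
    thus "x \<in> ?L" using lin_comb_unit[OF bs i(1)] i(2) by (metis imageI)
  qed
  ultimately have "module_span R M (set bs) \<subseteq> ?L" by (rule module_span_least)
  hence "v \<in> ?L" using v by (rule subsetD)
  thus ?thesis by (auto simp: image_iff)
qed

text \<open>A generating set of least size is a basis: in a relation among its elements, an element with a
  nonzero coefficient lies in the span of the others, so it could be dropped.\<close>

lemma fin_gen_module_basis: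
  assumes K: "field R" and fg: "fin_gen_module R M"
  shows "\<exists>bs. is_basis R M bs"
proof -
  interpret K: field R by fact
  let ?P = "\<lambda>A. finite A \<and> A \<subseteq> carrier M \<and> module_span R M A = carrier M"
  obtain A0 where "?P A0" using fg unfolding fin_gen_module_def by blast
  then obtain A where A: "?P A" and least: "\<And>B. ?P B \<Longrightarrow> card A \<le> card B"
    using ex_has_least_nat[of ?P A0 card] by blast
  obtain bs where bs: "set bs = A" "distinct bs" using A finite_distinct_list by blast
  let ?n = "length bs"
  have bsc: "set bs \<subseteq> carrier M" using bs A by simp
  have "c k = \<zero>" if c: "c \<in> coords R ?n" and z: "lin_comb M bs c = \<zero>\<^bsub>M\<^esub>" and k: "k < ?n" for c k
  proof (rule ccontr)
    assume ck: "c k \<noteq> \<zero>"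
    let ?B = "A - {bs ! k}"
    let ?N = "module_span R M ?B"
    have N: "submodule ?N R M" by (rule module_span_submodule) (use A in blast)
    have cl: "c i \<in> carrier R" "bs ! i \<in> carrier M" if "i < ?n" for i
      using c bsc that by (auto simp: coords_def)
    let ?r = "\<Oplus>\<^bsub>M\<^esub>i\<in>{..<?n} - {k}. c i \<odot>\<^bsub>M\<^esub> (bs ! i)"
    have r: "?r \<in> ?N"
    proof (rule submodule_finsum[OF N])
      fix i assume i: "i \<in> {..<?n} - {k}"
      hence "bs ! i \<in> ?B" using bs k by (auto simp: nth_eq_iff_index_eq)
      thus "c i \<odot>\<^bsub>M\<^esub> (bs ! i) \<in> ?N"
        using module_span_superset[of ?B] submoduleE(4)[OF N] cl i by blast
    qed simp
    have rc: "?r \<in> carrier M" using r submoduleE(1)[OF N] by blast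
    have "\<zero>\<^bsub>M\<^esub> = (\<Oplus>\<^bsub>M\<^esub>i\<in>insert k ({..<?n} - {k}). c i \<odot>\<^bsub>M\<^esub> (bs ! i))"
      using z k unfolding lin_comb_def by (simp add: insert_absorb)
    also have "\<dots> = c k \<odot>\<^bsub>M\<^esub> (bs ! k) \<oplus>\<^bsub>M\<^esub> ?r"
      by (rule M.finsum_insert) (use cl k in auto)
    finally have "c k \<odot>\<^bsub>M\<^esub> (bs ! k) = \<ominus>\<^bsub>M\<^esub> ?r"
      using rc cl k by (metis M.minus_equality smult_closed)
    hence "c k \<odot>\<^bsub>M\<^esub> (bs ! k) \<in> ?N" using r submoduleE(3)[OF N] by simp
    hence "inv c k \<odot>\<^bsub>M\<^esub> (c k \<odot>\<^bsub>M\<^esub> (bs ! k)) \<in> ?N"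
      using submoduleE(4)[OF N] K.field_Units cl(1)[OF k] ck by simp
    moreover have "inv c k \<odot>\<^bsub>M\<^esub> (c k \<odot>\<^bsub>M\<^esub> (bs ! k)) = bs ! k"
      using K.field_Units cl[OF k] ck by (simp flip: smult_assoc1)
    ultimately have "A \<subseteq> ?N" using module_span_superset[of ?B] by auto
    hence "carrier M \<subseteq> ?N" using module_span_least[OF N, of A] A by simp
    hence "?P ?B" using submoduleE(1)[OF N] A by auto
    hence "card A \<le> card ?B" by (rule least)
    moreover have "bs ! k \<in> A" using bs k by auto
    ultimately show False using A by (metis card_Diff1_less leD)
  qed
  moreover have "\<exists>c\<in>coords R ?n. v = lin_comb M bs c" if "v \<in> carrier M" for v
    using module_span_lin_comb[OF bsc] that bs A by simp
  ultimately show ?thesis using bsc unfolding is_basis_def by blast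
qed

lemma is_basis_some_basis:
  assumes "field R" "fin_gen_module R M"
  shows "is_basis R M (some_basis R M)"
  unfolding some_basis_def using fin_gen_module_basis[OF assms] by (rule someI_ex)

text \<open>By Zorn's lemma: the union of a chain of proper submodules is proper, for otherwise a member of
  the chain would contain the finitely many generators.\<close>

lemma exists_maximal_submodule:
  assumes fg: "fin_gen_module R M" and N: "submodule N R M" "N \<noteq> carrier M"
  shows "\<exists>P. submodule P R M \<and> P \<noteq> carrier M \<and> N \<subseteq> P \<and>
    (\<forall>Q. submodule Q R M \<and> P \<subseteq> Q \<longrightarrow> Q = P \<or> Q = carrier M)"
proof -
  define \<A> where "\<A> = {Q. submodule Q R M \<and> Q \<noteq> carrier M \<and> N \<subseteq> Q}"
  obtain G where G: "finite G" "G \<subseteq> carrier M" "module_span R M G = carrier M"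
    using fg by (auto simp: fin_gen_module_def)
  have notG: "\<not> G \<subseteq> Q" if "Q \<in> \<A>" for Q
    using that module_span_least[of Q G] G submoduleE(1)[of Q] by (auto simp: \<A>_def)
  have "\<exists>U\<in>\<A>. \<forall>Q\<in>C. Q \<subseteq> U" if C: "subset.chain \<A> C" for C
  proof (cases "C = {}")
    case True
    thus ?thesis using N by (auto simp: \<A>_def)
  next
    case False
    have sub: "C \<subseteq> \<A>" and tot: "\<And>Q Q'. Q \<in> C \<Longrightarrow> Q' \<in> C \<Longrightarrow> Q \<subseteq> Q' \<or> Q' \<subseteq> Q"
      using C by (auto simp: subset_chain_def)
    have sm: "submodule Q R M" if "Q \<in> C" for Q using that sub by (auto simp: \<A>_def)
    have "submodule (\<Union>C) R M"
    proof (rule submoduleI)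
      show "\<Union>C \<subseteq> carrier M" using submoduleE(1)[OF sm] by blast
      show "\<zero>\<^bsub>M\<^esub> \<in> \<Union>C" using False submodule_zero[OF sm] by blast
      show "\<ominus>\<^bsub>M\<^esub> a \<in> \<Union>C" if "a \<in> \<Union>C" for a using that submoduleE(3)[OF sm] by blast
      show "a \<odot>\<^bsub>M\<^esub> x \<in> \<Union>C" if "a \<in> carrier R" "x \<in> \<Union>C" for a x
        using that submoduleE(4)[OF sm] by blast
      fix a b assume "a \<in> \<Union>C" "b \<in> \<Union>C"
      then obtain Q Q' where QQ: "Q \<in> C" "Q' \<in> C" "a \<in> Q" "b \<in> Q'" by blast
      then obtain Z where "Z \<in> C" "a \<in> Z" "b \<in> Z" using tot[of Q Q'] by blast
      thus "a \<oplus>\<^bsub>M\<^esub> b \<in> \<Union>C" using submoduleE(5)[OF sm] by blast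
    qed
    moreover have "\<Union>C \<noteq> carrier M"
    proof
      assume "\<Union>C = carrier M"
      then obtain Q where "Q \<in> C" "G \<subseteq> Q"
        using finite_subset_Union_chain[OF G(1) _ False C] G(2) by blast
      thus False using notG sub by blast
    qed
    moreover have "N \<subseteq> \<Union>C" using False sub by (auto simp: \<A>_def)
    ultimately have "\<Union>C \<in> \<A>" by (simp add: \<A>_def)
    thus ?thesis by blast
  qed
  then obtain P where P: "P \<in> \<A>" "\<forall>Q\<in>\<A>. P \<subseteq> Q \<longrightarrow> Q = P"
    using subset_Zorn[of \<A>] by blast
  hence "Q = P \<or> Q = carrier M" if "submodule Q R M" "P \<subseteq> Q" for Q
    using that by (auto simp: \<A>_def)
  moreover have "submodule P R M" "P \<noteq> carrier M" "N \<subseteq> P" using P(1) by (auto simp: \<A>_def)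
  ultimately show ?thesis by blast
qed

end

section \<open>Reduction modulo an ideal\<close>

abbreviation residue :: "('a, 'm) ring_scheme \<Rightarrow> ('a, 'b, 'n) module_scheme \<Rightarrow> 'a set \<Rightarrow> 'b \<Rightarrow> 'b set"
  where "residue R M I x \<equiv> ideal_smult R M I +>\<^bsub>M\<^esub> x"

context Module.module
begin

lemma carrier_quot_module: "carrier (quot_module R M I) = residue R M I ` carrier M"
  by (auto simp: quot_module_def A_RCOSETS_def')

lemma carrier_FactRing: "carrier (R Quot I) = (\<lambda>a. I +> a) ` carrier R"
  by (auto simp: FactRing_def A_RCOSETS_def')

lemma residue_add:
  assumes I: "ideal I R" and x: "x \<in> carrier M" and y: "y \<in> carrier M"
  shows "residue R M I x \<oplus>\<^bsub>quot_module R M I\<^esub> residue R M I y = residue R M I (x \<oplus>\<^bsub>M\<^esub> y)"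
proof -
  have "I \<subseteq> carrier R" using I by (simp add: additive_subgroup.a_subset ideal.axioms(1))
  then interpret N: subgroup "ideal_smult R M I" "add_monoid M"
    using ideal_smult_submodule by (simp add: submodule_def)
  interpret AG: additive_subgroup "ideal_smult R M I" M by unfold_locales
  interpret ab: abelian_subgroup "ideal_smult R M I" M
    by (intro abelian_subgroupI3 AG.additive_subgroup_axioms M.abelian_group_axioms)
  show ?thesis using ab.a_rcos_sum[OF x y] by (simp add: quot_module_def)
qed

lemma residue_zero:
  assumes I: "ideal I R"
  shows "residue R M I \<zero>\<^bsub>M\<^esub> = \<zero>\<^bsub>quot_module R M I\<^esub>"
proof -
  have "I \<subseteq> carrier R" using I by (simp add: additive_subgroup.a_subset ideal.axioms(1))
  hence "ideal_smult R M I \<subseteq> carrier M" using submoduleE(1)[OF ideal_smult_submodule] by blast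
  thus ?thesis using M.a_coset_add_zero by (simp add: quot_module_def)
qed

lemma residue_eq_iff:
  assumes I: "ideal I R" and x: "x \<in> carrier M" and y: "y \<in> carrier M"
  shows "residue R M I x = residue R M I y \<longleftrightarrow> x \<ominus>\<^bsub>M\<^esub> y \<in> ideal_smult R M I"
proof -
  let ?N = "ideal_smult R M I"
  have "I \<subseteq> carrier R" using I by (simp add: additive_subgroup.a_subset ideal.axioms(1))
  hence N: "submodule ?N R M" by (rule ideal_smult_submodule)
  hence sg: "subgroup ?N (add_monoid M)" by (simp add: submodule_def)
  note NE = submoduleE[OF N]
  show ?thesis
  proof
    assume eq: "residue R M I x = residue R M I y"
    have "\<zero>\<^bsub>M\<^esub> \<oplus>\<^bsub>M\<^esub> x \<in> residue R M I x"
      using submodule_zero[OF N] unfolding a_r_coset_def' by blast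
    hence "x \<in> residue R M I y" using x eq by simp
    then obtain h where h: "h \<in> ?N" "x = h \<oplus>\<^bsub>M\<^esub> y" unfolding a_r_coset_def' by blast
    have "h \<in> carrier M" using h NE(1) by blast
    hence "x \<ominus>\<^bsub>M\<^esub> y = h" using h y by (simp add: a_minus_def M.a_assoc M.r_neg)
    thus "x \<ominus>\<^bsub>M\<^esub> y \<in> ?N" using h by simp
  next
    assume "x \<ominus>\<^bsub>M\<^esub> y \<in> ?N"
    moreover have "(x \<ominus>\<^bsub>M\<^esub> y) \<oplus>\<^bsub>M\<^esub> y = x"
      using x y by (simp add: a_minus_def M.a_assoc M.l_neg)
    ultimately have "x \<in> residue R M I y" unfolding a_r_coset_def' by force
    thus "residue R M I x = residue R M I y"
      using M.a_repr_independence[OF _ y sg] by simp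
  qed
qed

lemma residue_vimage_submodule:
  assumes I: "ideal I R" and W: "submodule W (R Quot I) (quot_module R M I)"
  shows "submodule {x \<in> carrier M. residue R M I x \<in> W} R M"
proof -
  interpret Q: Module.module "R Quot I" "quot_module R M I" by (rule quot_module_module[OF I])
  note WE = Q.submoduleE[OF W]
  have sm: "residue R M I (a \<odot>\<^bsub>M\<^esub> x) \<in> W"
    if a: "a \<in> carrier R" and x: "x \<in> carrier M" "residue R M I x \<in> W" for a x
  proof -
    have "I +> a \<in> carrier (R Quot I)" using a by (simp add: carrier_FactRing)
    thus ?thesis using WE(4) x quot_module_smult[OF I a x(1)] by metis
  qed
  show ?thesis
  proof (rule submoduleI)
    show "\<zero>\<^bsub>M\<^esub> \<in> {x \<in> carrier M. residue R M I x \<in> W}"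
      using Q.submodule_zero[OF W] by (simp add: residue_zero[OF I])
    show "\<ominus>\<^bsub>M\<^esub> a \<in> {x \<in> carrier M. residue R M I x \<in> W}"
      if "a \<in> {x \<in> carrier M. residue R M I x \<in> W}" for a
      using sm[of "\<ominus> \<one>" a] that by (simp add: smult_l_minus)
    show "a \<oplus>\<^bsub>M\<^esub> b \<in> {x \<in> carrier M. residue R M I x \<in> W}"
      if "a \<in> {x \<in> carrier M. residue R M I x \<in> W}" "b \<in> {x \<in> carrier M. residue R M I x \<in> W}" for a b
      using that WE(5) by (auto simp flip: residue_add[OF I])
  qed (use sm in auto)
qed

lemma residue_image_submodule:
  assumes I: "ideal I R" and P: "submodule P R M"
  shows "submodule (residue R M I ` P) (R Quot I) (quot_module R M I)"
proof -
  interpret Q: Module.module "R Quot I" "quot_module R M I" by (rule quot_module_module[OF I])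
  note PE = submoduleE[OF P]
  let ?W = "residue R M I ` P"
  have sm: "A \<odot>\<^bsub>quot_module R M I\<^esub> w \<in> ?W" if A: "A \<in> carrier (R Quot I)" and w: "w \<in> ?W" for A w
  proof -
    obtain a x where a: "a \<in> carrier R" "A = I +> a" and x: "x \<in> P" "w = residue R M I x"
      using A w by (auto simp: carrier_FactRing)
    have "x \<in> carrier M" using x PE(1) by blast
    hence "A \<odot>\<^bsub>quot_module R M I\<^esub> w = residue R M I (a \<odot>\<^bsub>M\<^esub> x)"
      using quot_module_smult[OF I a(1)] a(2) x(2) by simp
    thus ?thesis using PE(4)[OF a(1) x(1)] by simp
  qed
  have sub: "?W \<subseteq> carrier (quot_module R M I)" using PE(1) by (auto simp: carrier_quot_module)
  show ?thesis
  proof (rule Q.submoduleI)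
    show "?W \<subseteq> carrier (quot_module R M I)" by (rule sub)
    show "\<zero>\<^bsub>quot_module R M I\<^esub> \<in> ?W"
      unfolding residue_zero[OF I, symmetric] using submodule_zero[OF P] by blast
    show "\<ominus>\<^bsub>quot_module R M I\<^esub> w \<in> ?W" if w: "w \<in> ?W" for w
    proof -
      have "w \<in> carrier (quot_module R M I)" using w sub by blast
      hence "\<ominus>\<^bsub>quot_module R M I\<^esub> w = (\<ominus>\<^bsub>R Quot I\<^esub> \<one>\<^bsub>R Quot I\<^esub>) \<odot>\<^bsub>quot_module R M I\<^esub> w"
        by (simp add: Q.smult_l_minus)
      thus ?thesis using sm[of "\<ominus>\<^bsub>R Quot I\<^esub> \<one>\<^bsub>R Quot I\<^esub>" w] w by simp
    qed
    fix v w assume "v \<in> ?W" "w \<in> ?W"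
    then obtain x y where xy: "x \<in> P" "y \<in> P" "v = residue R M I x" "w = residue R M I y" by blast
    have "x \<in> carrier M" "y \<in> carrier M" using xy PE(1) by auto
    hence "v \<oplus>\<^bsub>quot_module R M I\<^esub> w = residue R M I (x \<oplus>\<^bsub>M\<^esub> y)"
      unfolding xy(3,4) by (rule residue_add[OF I])
    thus "v \<oplus>\<^bsub>quot_module R M I\<^esub> w \<in> ?W" using PE(5) xy by blast
  qed (rule sm)
qed

text \<open>A submodule that contains \<open>IM\<close> is a union of cosets of \<open>IM\<close>, so it is recovered from its image
  in \<open>M/IM\<close>.\<close>

lemma residue_mem_image_iff:
  assumes I: "ideal I R" and P: "submodule P R M" "ideal_smult R M I \<subseteq> P" and x: "x \<in> carrier M"
  shows "residue R M I x \<in> residue R M I ` P \<longleftrightarrow> x \<in> P"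
proof
  assume "residue R M I x \<in> residue R M I ` P"
  then obtain y where y: "y \<in> P" "residue R M I x = residue R M I y" by blast
  have yc: "y \<in> carrier M" using y submoduleE(1)[OF P(1)] by blast
  hence "x \<ominus>\<^bsub>M\<^esub> y \<in> P" using residue_eq_iff[OF I x] y P(2) by blast
  hence "(x \<ominus>\<^bsub>M\<^esub> y) \<oplus>\<^bsub>M\<^esub> y \<in> P" using submoduleE(5)[OF P(1)] y by blast
  moreover have "(x \<ominus>\<^bsub>M\<^esub> y) \<oplus>\<^bsub>M\<^esub> y = x"
    using x yc by (simp add: a_minus_def M.a_assoc M.l_neg)
  ultimately show "x \<in> P" by simp
qed simp

text \<open>The preimage of the span of the residues of the generators is a submodule that contains the
  generators, so it is all of \<open>M\<close>.\<close>

lemma quot_module_fin_gen: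
  assumes I: "ideal I R" and fg: "fin_gen_module R M"
  shows "fin_gen_module (R Quot I) (quot_module R M I)"
proof -
  interpret Q: Module.module "R Quot I" "quot_module R M I" by (rule quot_module_module[OF I])
  obtain G where G: "finite G" "G \<subseteq> carrier M" "module_span R M G = carrier M"
    using fg by (auto simp: fin_gen_module_def)
  let ?G = "residue R M I ` G"
  let ?S = "module_span (R Quot I) (quot_module R M I) ?G"
  have Gc: "?G \<subseteq> carrier (quot_module R M I)" using G(2) by (auto simp: carrier_quot_module)
  have S: "submodule ?S (R Quot I) (quot_module R M I)" by (rule Q.module_span_submodule[OF Gc])
  have "G \<subseteq> {x \<in> carrier M. residue R M I x \<in> ?S}"
    using G(2) Q.module_span_superset[of ?G] by blast
  hence "carrier M \<subseteq> {x \<in> carrier M. residue R M I x \<in> ?S}"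
    using module_span_least[OF residue_vimage_submodule[OF I S], of G] G(3) by simp
  hence "carrier (quot_module R M I) \<subseteq> ?S" by (auto simp: carrier_quot_module)
  hence "?S = carrier (quot_module R M I)" using Q.submoduleE(1)[OF S] by blast
  thus ?thesis unfolding fin_gen_module_def using Gc G(1) by blast
qed

section \<open>The Chinese remainder theorem\<close>

text \<open>For a single \<open>J \<noteq> I\<close>, some \<open>l \<in> J\<close> is nonzero in the field \<open>R/I\<close>, and the product of \<open>l\<close> with
  a representative of its inverse is congruent to \<open>\<one>\<close> modulo \<open>I\<close>. For a finite family, multiply the
  elements obtained for its members.\<close>

lemma maximal_ideals_separating_element:
  assumes fin: "finite \<F>" and F: "\<And>J. J \<in> \<F> \<Longrightarrow> maximalideal J R"
    and I: "maximalideal I R" "I \<notin> \<F>"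
  shows "\<exists>e \<in> carrier R. \<one> \<ominus> e \<in> I \<and> (\<forall>J\<in>\<F>. e \<in> J)"
  using fin F I(2)
proof (induction \<F> rule: finite_induct)
  case empty
  interpret I: maximalideal I R by (rule I)
  show ?case by (intro bexI[of _ \<one>]) (auto simp: a_minus_def R.r_neg)
next
  case (insert J \<F>)
  interpret I: maximalideal I R by (rule I)
  interpret J: maximalideal J R using insert by blast
  obtain e where e: "e \<in> carrier R" "\<one> \<ominus> e \<in> I" "\<And>J. J \<in> \<F> \<Longrightarrow> e \<in> J"
  proof -
    have "\<exists>e \<in> carrier R. \<one> \<ominus> e \<in> I \<and> (\<forall>J\<in>\<F>. e \<in> J)"
      by (rule insert.IH) (use insert.prems in auto)
    thus ?thesis using that by blast
  qed
  have "\<not> J \<subseteq> I"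
    using J.I_maximal[OF I.is_ideal] I.I_notcarr I.a_subset insert.prems(2) by blast
  then obtain l where l: "l \<in> J" "l \<notin> I" by blast
  have lc: "l \<in> carrier R" using l J.a_subset by blast
  interpret F: field "R Quot I" by (rule I.quotient_is_field[OF R.is_cring])
  have "I +> l \<noteq> \<zero>\<^bsub>R Quot I\<^esub>" using I.a_rcos_self[OF lc] l by (auto simp: FactRing_def)
  moreover have "I +> l \<in> carrier (R Quot I)" using lc by (simp add: carrier_FactRing)
  ultimately obtain K where "K \<in> carrier (R Quot I)" "(I +> l) \<otimes>\<^bsub>R Quot I\<^esub> K = \<one>\<^bsub>R Quot I\<^esub>"
    using F.field_Units F.Units_r_inv F.Units_inv_closed by (metis Diff_iff singletonD)
  then obtain k where k: "k \<in> carrier R" "(I +> l) \<otimes>\<^bsub>R Quot I\<^esub> (I +> k) = \<one>\<^bsub>R Quot I\<^esub>"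
    by (auto simp: carrier_FactRing)
  hence "I +> l \<otimes> k = I +> \<one>" using I.rcoset_mult_add[OF lc k(1)] by (simp add: FactRing_def)
  hence "\<one> \<in> I +> l \<otimes> k" using I.a_rcos_self[of \<one>] by simp
  then obtain i where "i \<in> I" "\<one> = i \<oplus> l \<otimes> k" unfolding a_r_coset_def' by blast
  moreover have "l \<otimes> k \<in> J" using l k by (simp add: J.I_r_closed)
  ultimately obtain j where ij: "i \<in> I" "j \<in> J" "\<one> = i \<oplus> j" by blast
  have c: "i \<in> carrier R" "j \<in> carrier R" using ij I.Icarr J.Icarr by auto
  have "\<one> \<ominus> e \<otimes> j = (\<one> \<ominus> e) \<oplus> e \<otimes> i"
  proof -
    have "i = \<one> \<ominus> j" using ij(3) c by (simp add: a_minus_def R.a_assoc R.r_neg)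
    thus ?thesis using e(1) c by (simp add: R.r_distr R.r_minus a_minus_def R.a_assoc R.r_neg1)
  qed
  also have "\<dots> \<in> I" using e ij c by (intro I.a_closed I.I_l_closed) auto
  finally have "\<one> \<ominus> e \<otimes> j \<in> I" .
  moreover have "e \<otimes> j \<in> J'" if "J' \<in> insert J \<F>" for J'
  proof (cases "J' = J")
    case True
    thus ?thesis using ij(2) e(1) by (simp add: J.I_l_closed)
  next
    case False
    hence J': "J' \<in> \<F>" using that by blast
    then interpret J': maximalideal J' R using insert by blast
    show ?thesis using e(3)[OF J'] c by (simp add: J'.I_r_closed)
  qed
  ultimately show ?case using e(1) c by blast
qed

text \<open>To a solution \<open>x\<close> for the ideals in \<open>\<F>\<close>, add \<open>e (t I - x)\<close> with \<open>e\<close> in all of them and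
  \<open>e\<close> congruent to \<open>\<one>\<close> modulo the new ideal \<open>I\<close>: this changes nothing modulo the old ideals and moves \<open>x\<close> to
  \<open>t I\<close> modulo \<open>I\<close>.\<close>

lemma residues_surjective:
  assumes fin: "finite \<F>" and F: "\<And>J. J \<in> \<F> \<Longrightarrow> maximalideal J R"
    and t: "\<And>J. J \<in> \<F> \<Longrightarrow> t J \<in> carrier M"
  shows "\<exists>x \<in> carrier M. \<forall>J\<in>\<F>. residue R M J x = residue R M J (t J)"
  using fin F t
proof (induction \<F> rule: finite_induct)
  case empty
  thus ?case using M.zero_closed by blast
next
  case (insert I \<F>)
  then obtain x where x: "x \<in> carrier M" "\<And>J. J \<in> \<F> \<Longrightarrow> residue R M J x = residue R M J (t J)"
  proof -
    have "\<exists>x \<in> carrier M. \<forall>J\<in>\<F>. residue R M J x = residue R M J (t J)"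
      by (rule insert.IH) (use insert.prems in auto)
    thus ?thesis using that by blast
  qed
  have max: "maximalideal I R" "\<And>J. J \<in> \<F> \<Longrightarrow> maximalideal J R" using insert by auto
  have I: "ideal I R" and id: "\<And>J. J \<in> \<F> \<Longrightarrow> ideal J R"
    using max by (auto simp: maximalideal_def)
  obtain e where e: "e \<in> carrier R" "\<one> \<ominus> e \<in> I" "\<And>J. J \<in> \<F> \<Longrightarrow> e \<in> J"
    using maximal_ideals_separating_element[OF insert(1) max(2) max(1) insert(2)] by blast
  have tI: "t I \<in> carrier M" using insert by blast
  define y where "y = x \<oplus>\<^bsub>M\<^esub> e \<odot>\<^bsub>M\<^esub> (t I \<ominus>\<^bsub>M\<^esub> x)"
  have y: "y \<in> carrier M" unfolding y_def using x e tI by simp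
  have "y \<ominus>\<^bsub>M\<^esub> x = e \<odot>\<^bsub>M\<^esub> (t I \<ominus>\<^bsub>M\<^esub> x)"
  proof -
    have "e \<odot>\<^bsub>M\<^esub> (t I \<ominus>\<^bsub>M\<^esub> x) \<in> carrier M" using x e tI by simp
    thus ?thesis unfolding y_def using x(1) M.a_comm[OF x(1), of "e \<odot>\<^bsub>M\<^esub> (t I \<ominus>\<^bsub>M\<^esub> x)"]
      by (simp add: a_minus_def M.a_assoc M.r_neg)
  qed
  hence "residue R M J y = residue R M J (t J)" if J: "J \<in> \<F>" for J
    using residue_eq_iff[OF id[OF J] y x(1)] x e(3)[OF J] tI J
    by (simp add: ideal_smultI)
  moreover have "residue R M I y = residue R M I (t I)"
  proof -
    have "y \<ominus>\<^bsub>M\<^esub> t I = (\<one> \<ominus> e) \<odot>\<^bsub>M\<^esub> (x \<ominus>\<^bsub>M\<^esub> t I)"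
    proof -
      have "e \<odot>\<^bsub>M\<^esub> (t I \<ominus>\<^bsub>M\<^esub> x) = (\<ominus> e) \<odot>\<^bsub>M\<^esub> (x \<ominus>\<^bsub>M\<^esub> t I)"
      proof -
        have "t I \<ominus>\<^bsub>M\<^esub> x = \<ominus>\<^bsub>M\<^esub> (x \<ominus>\<^bsub>M\<^esub> t I)"
          using x tI by (simp add: a_minus_def M.minus_add M.a_comm)
        thus ?thesis using x tI e(1) by (simp add: smult_l_minus smult_r_minus)
      qed
      hence "y \<ominus>\<^bsub>M\<^esub> t I = (x \<ominus>\<^bsub>M\<^esub> t I) \<oplus>\<^bsub>M\<^esub> (\<ominus> e) \<odot>\<^bsub>M\<^esub> (x \<ominus>\<^bsub>M\<^esub> t I)"
        unfolding y_def using x tI e(1) by (simp add: a_minus_def M.a_ac)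
      also have "\<dots> = (\<one> \<ominus> e) \<odot>\<^bsub>M\<^esub> (x \<ominus>\<^bsub>M\<^esub> t I)"
        using x tI e(1) smult_l_distr[of \<one> "\<ominus> e" "x \<ominus>\<^bsub>M\<^esub> t I"] by (simp add: a_minus_def[of R])
      finally show ?thesis .
    qed
    also have "\<dots> \<in> ideal_smult R M I" using e(2) x tI by (intro ideal_smultI) auto
    finally show ?thesis using residue_eq_iff[OF I y tI] by simp
  qed
  ultimately show ?case using y by blast
qed

end

section \<open>Irreducibility of affine space over an infinite field\<close>

text \<open>A polynomial in several variables can have infinitely many zeros. Parametrising a line turns it
  into a univariate polynomial, given by its list of coefficients, whose zeros can be counted.\<close>

lemma (in cring) mpoly_eval_on_line:
  assumes p: "p \<in> mpolys R n" and c: "c \<in> coords R n" and d: "d \<in> coords R n"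
  shows "\<exists>f. set f \<subseteq> carrier R \<and>
    (\<forall>t\<in>carrier R. mpoly_eval R p (\<lambda>i\<in>{..<n}. c i \<oplus> t \<otimes> d i) = eval f t)"
proof -
  have ci: "c i \<in> carrier R" "d i \<in> carrier R" if "i < n" for i
    using that c d by (auto simp: coords_def)
  let ?l = "\<lambda>t. \<lambda>i\<in>{..<n}. c i \<oplus> t \<otimes> d i"
  have l: "?l t \<in> coords R n" if "t \<in> carrier R" for t
    by (rule coordsI) (use ci that in auto)
  have "p \<in> indexed_pset {..<n} (carrier R)" using p by (simp add: mpolys_def)
  thus ?thesis
  proof induction
    case (indexed_const k)
    thus ?case by (intro exI[of _ "[k]"]) (simp add: mpoly_eval_const)
  next
    case (indexed_padd p q)
    then obtain f g where f: "set f \<subseteq> carrier R" "\<forall>t\<in>carrier R. mpoly_eval R p (?l t) = eval f t"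
      and g: "set g \<subseteq> carrier R" "\<forall>t\<in>carrier R. mpoly_eval R q (?l t) = eval g t" by blast
    have pq: "p \<in> mpolys R n" "q \<in> mpolys R n" using indexed_padd by (auto simp: mpolys_def)
    show ?case
    proof (intro exI[of _ "poly_add f g"] conjI ballI)
      show "set (poly_add f g) \<subseteq> carrier R" by (rule poly_add_in_carrier[OF f(1) g(1)])
      fix t assume t: "t \<in> carrier R"
      show "mpoly_eval R (indexed_padd p q) (?l t) = eval (poly_add f g) t"
        using mpoly_eval_padd[OF pq l[OF t]] eval_poly_add[OF f(1) g(1) t] f(2) g(2) t by simp
    qed
  next
    case (indexed_pmult p i)
    then obtain f where f: "set f \<subseteq> carrier R" "\<forall>t\<in>carrier R. mpoly_eval R p (?l t) = eval f t"
      by blast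
    have p: "p \<in> mpolys R n" and i: "i < n" using indexed_pmult by (auto simp: mpolys_def)
    let ?g = "[d i, c i]"
    have g: "set ?g \<subseteq> carrier R" using ci[OF i] by simp
    show ?case
    proof (intro exI[of _ "poly_mult f ?g"] conjI ballI)
      show "set (poly_mult f ?g) \<subseteq> carrier R" by (rule poly_mult_in_carrier[OF f(1) g])
      fix t assume t: "t \<in> carrier R"
      have "eval ?g t = c i \<oplus> t \<otimes> d i" using ci[OF i] t by (simp add: m_comm a_comm)
      thus "mpoly_eval R (indexed_pmult p i) (?l t) = eval (poly_mult f ?g) t"
        using mpoly_eval_pmult[OF p i l[OF t]] eval_poly_mult[OF f(1) g t] f(2) t i by simp
    qed
  qed
qed

lemma (in domain) finite_zeros_eval:
  assumes f: "set f \<subseteq> carrier R" and s: "s \<in> carrier R" "eval f s \<noteq> \<zero>"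
  shows "finite {t \<in> carrier R. eval f t = \<zero>}"
proof -
  let ?f = "normalize f"
  have f': "eval ?f t = eval f t" if "t \<in> carrier R" for t by (rule eval_normalize[OF f that])
  have "polynomial (carrier R) ?f" by (rule normalize_gives_polynomial[OF f])
  hence "finite {t. is_root ?f t}" by (intro finite_number_of_roots) (simp add: univ_poly_carrier)
  moreover have "?f \<noteq> []" using f'[OF s(1)] s(2) by auto
  hence "{t \<in> carrier R. eval f t = \<zero>} \<subseteq> {t. is_root ?f t}" by (auto simp: is_root_def f')
  ultimately show ?thesis by (rule finite_subset[rotated])
qed

text \<open>On the line through \<open>c\<close> and \<open>d\<close> neither polynomial vanishes identically, so each has only
  finitely many zeros there, and an infinite domain leaves a parameter that avoids both sets.\<close>

lemma (in domain) mpolys_common_nonzero: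
  assumes inf: "infinite (carrier R)" and p: "p \<in> mpolys R n" and q: "q \<in> mpolys R n"
    and c: "c \<in> coords R n" "mpoly_eval R p c \<noteq> \<zero>"
    and d: "d \<in> coords R n" "mpoly_eval R q d \<noteq> \<zero>"
  shows "\<exists>e\<in>coords R n. mpoly_eval R p e \<noteq> \<zero> \<and> mpoly_eval R q e \<noteq> \<zero>"
proof -
  define b where "b = (\<lambda>i\<in>{..<n}. d i \<ominus> c i)"
  have cl: "c i \<in> carrier R" "d i \<in> carrier R" if "i < n" for i
    using that c d by (auto simp: coords_def)
  have b: "b \<in> coords R n" unfolding b_def by (rule coordsI) (use cl in auto)
  let ?l = "\<lambda>t. \<lambda>i\<in>{..<n}. c i \<oplus> t \<otimes> b i"
  have l: "?l t \<in> coords R n" if "t \<in> carrier R" for t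
    by (rule coordsI) (use cl that in \<open>auto simp: b_def\<close>)
  \<comment> \<open>The line passes through \<open>c\<close> at parameter \<open>\<zero>\<close> and through \<open>d\<close> at parameter \<open>\<one>\<close>.\<close>
  have l0: "?l \<zero> = c"
    using c(1) cl by (auto simp: fun_eq_iff b_def coords_def PiE_def extensional_def)
  have "c i \<oplus> (d i \<ominus> c i) = d i" if "i < n" for i
    using cl[OF that] by (simp add: a_minus_def a_comm[of "d i"] r_neg2)
  hence l1: "?l \<one> = d"
    using d(1) cl by (auto simp: fun_eq_iff b_def coords_def PiE_def extensional_def)
  obtain f where f: "set f \<subseteq> carrier R" "\<And>t. t \<in> carrier R \<Longrightarrow> mpoly_eval R p (?l t) = eval f t"
    using mpoly_eval_on_line[OF p c(1) b] by blast
  obtain g where g: "set g \<subseteq> carrier R" "\<And>t. t \<in> carrier R \<Longrightarrow> mpoly_eval R q (?l t) = eval g t"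
    using mpoly_eval_on_line[OF q c(1) b] by blast
  have "eval f \<zero> \<noteq> \<zero>" using f(2)[of \<zero>] c(2) l0 by simp
  hence "finite {t \<in> carrier R. eval f t = \<zero>}" using finite_zeros_eval[OF f(1) zero_closed] by blast
  moreover have "eval g \<one> \<noteq> \<zero>" using g(2)[of \<one>] d(2) l1 by simp
  hence "finite {t \<in> carrier R. eval g t = \<zero>}" using finite_zeros_eval[OF g(1) one_closed] by blast
  ultimately have "finite ({t \<in> carrier R. eval f t = \<zero>} \<union> {t \<in> carrier R. eval g t = \<zero>})" by simp
  hence "\<not> carrier R \<subseteq> {t \<in> carrier R. eval f t = \<zero>} \<union> {t \<in> carrier R. eval g t = \<zero>}"
    using inf finite_subset by blast
  then obtain t where t: "t \<in> carrier R" "eval f t \<noteq> \<zero>" "eval g t \<noteq> \<zero>" by blast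
  thus ?thesis using l[OF t(1)] f(2)[OF t(1)] g(2)[OF t(1)] by metis
qed

text \<open>Each of two proper closed sets lies in the zero set of a single polynomial that does not vanish
  everywhere, and two such polynomials are nonzero at a common point.\<close>

lemma (in Module.module) zariski_topology_irreducible:
  assumes K: "field R" and inf: "infinite (carrier R)" and b: "is_basis R M bs"
  shows "\<not> reducible_space (zariski_topology R M)"
proof
  interpret K: field R by fact
  note top = closedin_zariski_topology[OF K.domain_axioms b]
  let ?n = "length bs" and ?L = "lin_comb M bs"
  have L: "inj_on ?L (coords R ?n)" "?L ` coords R ?n = carrier M"
    using basis_bij_betw[OF b] by (auto simp: bij_betw_def)
  have outside: "\<exists>p\<in>mpolys R ?n. \<exists>c\<in>coords R ?n. mpoly_eval R p c \<noteq> \<zero> \<and>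
      (\<forall>e\<in>coords R ?n. ?L e \<in> C \<longrightarrow> mpoly_eval R p e = \<zero>)"
    if C: "zariski_closed R M bs C" "C \<noteq> carrier M" for C
  proof -
    obtain F where F: "F \<subseteq> mpolys R ?n" "C = ?L ` zero_set R ?n F"
      using C(1) by (auto simp: zariski_closed_def)
    have sub: "zero_set R ?n F \<subseteq> coords R ?n" by (auto simp: zero_set_def)
    have "zero_set R ?n F \<noteq> coords R ?n" using F(2) L(2) C(2) by auto
    then obtain c p where "c \<in> coords R ?n" "p \<in> F" "mpoly_eval R p c \<noteq> \<zero>"
      by (auto simp: zero_set_def)
    moreover have "mpoly_eval R p e = \<zero>" if "e \<in> coords R ?n" "?L e \<in> C" for e
      using inj_on_image_mem_iff[OF L(1) that(1) sub] that(2) F(2) \<open>p \<in> F\<close>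
      by (auto simp: zero_set_def)
    ultimately show ?thesis using F(1) by blast
  qed
  assume "reducible_space (zariski_topology R M)"
  then obtain A B where "zariski_closed R M bs A" "A \<noteq> carrier M"
      "zariski_closed R M bs B" "B \<noteq> carrier M" and AB: "A \<union> B = carrier M"
    unfolding reducible_space_def top by blast
  then obtain p c q d where p: "p \<in> mpolys R ?n" "c \<in> coords R ?n" "mpoly_eval R p c \<noteq> \<zero>"
      "\<forall>e\<in>coords R ?n. ?L e \<in> A \<longrightarrow> mpoly_eval R p e = \<zero>"
    and q: "q \<in> mpolys R ?n" "d \<in> coords R ?n" "mpoly_eval R q d \<noteq> \<zero>"
      "\<forall>e\<in>coords R ?n. ?L e \<in> B \<longrightarrow> mpoly_eval R q e = \<zero>"
    using outside[of A] outside[of B] by blast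
  obtain e where "e \<in> coords R ?n" "mpoly_eval R p e \<noteq> \<zero>" "mpoly_eval R q e \<noteq> \<zero>"
    using K.mpolys_common_nonzero[OF inf p(1) q(1) p(2,3) q(2,3)] by blast
  moreover from this have "?L e \<in> A \<union> B" using AB L(2) by blast
  ultimately show False using p(4) q(4) by blast
qed

lemma three_set_topology_irreducible:
  assumes "\<zero>\<^bsub>V\<^esub> \<in> carrier V"
  shows "\<not> reducible_space (three_set_topology V)"
  using assms unfolding reducible_space_def closedin_three_set_topology[OF assms] by auto

section \<open>Hyperplanes and lines in a vector space\<close>

context Module.module
begin

text \<open>In coordinates, \<open>W\<close> is the zero set of a linear form: the one that reads off the coefficient
  of \<open>v\<close> modulo \<open>W\<close>.\<close>

lemma zariski_closed_hyperplane:
  assumes K: "field R" and b: "is_basis R M bs" and W: "submodule W R M"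
    and v: "v \<in> carrier M" "v \<notin> W"
    and dec: "\<And>x. x \<in> carrier M \<Longrightarrow> \<exists>a\<in>carrier R. \<exists>w\<in>W. x = w \<oplus>\<^bsub>M\<^esub> a \<odot>\<^bsub>M\<^esub> v"
  shows "zariski_closed R M bs W"
proof -
  interpret K: field R by fact
  let ?n = "length bs" and ?L = "lin_comb M bs"
  note WE = submoduleE[OF W]
  have bs: "set bs \<subseteq> carrier M" using b by (simp add: is_basis_def)
  have "\<exists>p\<in>mpolys R ?n. \<forall>c\<in>coords R ?n. \<exists>w\<in>W.
      (\<Oplus>\<^bsub>M\<^esub>i\<in>{..<m}. c i \<odot>\<^bsub>M\<^esub> (bs ! i)) = w \<oplus>\<^bsub>M\<^esub> mpoly_eval R p c \<odot>\<^bsub>M\<^esub> v"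
    if "m \<le> ?n" for m
    using that
  proof (induction m)
    case 0
    have "\<forall>c\<in>coords R ?n. \<exists>w\<in>W. \<zero>\<^bsub>M\<^esub> = w \<oplus>\<^bsub>M\<^esub> mpoly_eval R (indexed_const \<zero>) c \<odot>\<^bsub>M\<^esub> v"
      using submodule_zero[OF W] v by (intro ballI bexI[of _ "\<zero>\<^bsub>M\<^esub>"]) (auto simp: mpoly_eval_const)
    thus ?case
      by (intro bexI[of _ "indexed_const \<zero>"]) (auto simp: mpolys_def intro: indexed_pset.indexed_const)
  next
    case (Suc m)
    hence m: "m < ?n" by simp
    obtain p where p: "p \<in> mpolys R ?n" and pe: "\<And>c. c \<in> coords R ?n \<Longrightarrow> \<exists>w\<in>W.
        (\<Oplus>\<^bsub>M\<^esub>i\<in>{..<m}. c i \<odot>\<^bsub>M\<^esub> (bs ! i)) = w \<oplus>\<^bsub>M\<^esub> mpoly_eval R p c \<odot>\<^bsub>M\<^esub> v"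
      using Suc.IH m by (meson less_imp_le_nat)
    have bc: "bs ! i \<in> carrier M" if "i < ?n" for i using bs that by auto
    obtain a u where a: "a \<in> carrier R" and u: "u \<in> W" "bs ! m = u \<oplus>\<^bsub>M\<^esub> a \<odot>\<^bsub>M\<^esub> v"
      using dec[OF bc[OF m]] by blast
    have uc: "u \<in> carrier M" using u WE(1) by blast
    have t: "indexed_const a \<in> mpolys R ?n" "indexed_pmult (indexed_const a) m \<in> mpolys R ?n"
      using a m by (auto simp: mpolys_def intro!: indexed_pset.indexed_const indexed_pset.indexed_pmult)
    define r where "r = indexed_padd p (indexed_pmult (indexed_const a) m)"
    have r: "r \<in> mpolys R ?n"
      using p t by (auto simp: r_def mpolys_def intro: indexed_pset.indexed_padd)
    have "\<exists>w\<in>W. (\<Oplus>\<^bsub>M\<^esub>i\<in>{..<Suc m}. c i \<odot>\<^bsub>M\<^esub> (bs ! i)) = w \<oplus>\<^bsub>M\<^esub> mpoly_eval R r c \<odot>\<^bsub>M\<^esub> v"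
      if c: "c \<in> coords R ?n" for c
    proof -
      have ci: "c i \<in> carrier R" if "i < ?n" for i using c that by (auto simp: coords_def)
      have cm: "c m \<in> carrier R" using ci m by blast
      have pc: "mpoly_eval R p c \<in> carrier R" by (rule mpoly_eval_closed[OF p c])
      obtain w where w: "w \<in> W" "(\<Oplus>\<^bsub>M\<^esub>i\<in>{..<m}. c i \<odot>\<^bsub>M\<^esub> (bs ! i)) = w \<oplus>\<^bsub>M\<^esub> mpoly_eval R p c \<odot>\<^bsub>M\<^esub> v"
        using pe[OF c] by blast
      have wc: "w \<in> carrier M" using w WE(1) by blast
      have "(\<Oplus>\<^bsub>M\<^esub>i\<in>{..<Suc m}. c i \<odot>\<^bsub>M\<^esub> (bs ! i))
          = c m \<odot>\<^bsub>M\<^esub> (bs ! m) \<oplus>\<^bsub>M\<^esub> (\<Oplus>\<^bsub>M\<^esub>i\<in>{..<m}. c i \<odot>\<^bsub>M\<^esub> (bs ! i))"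
        unfolding lessThan_Suc by (rule M.finsum_insert) (use ci bc m in auto)
      also have "\<dots> = (c m \<odot>\<^bsub>M\<^esub> u \<oplus>\<^bsub>M\<^esub> w) \<oplus>\<^bsub>M\<^esub> (mpoly_eval R p c \<oplus> a \<otimes> c m) \<odot>\<^bsub>M\<^esub> v"
        unfolding w(2) u(2) using a uc wc cm pc v(1)
        by (simp add: smult_r_distr smult_l_distr smult_assoc1[symmetric] R.m_comm M.a_ac)
      also have "mpoly_eval R p c \<oplus> a \<otimes> c m = mpoly_eval R r c"
        using mpoly_eval_padd[OF p t(2) c] mpoly_eval_pmult[OF t(1) m c] a
        by (simp add: r_def mpoly_eval_const)
      finally show ?thesis using WE(4)[OF cm u(1)] WE(5) w(1) by blast
    qed
    thus ?case using r by blast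
  qed
  from this[of ?n] obtain p where p: "p \<in> mpolys R ?n"
    and pe: "\<And>c. c \<in> coords R ?n \<Longrightarrow> \<exists>w\<in>W. ?L c = w \<oplus>\<^bsub>M\<^esub> mpoly_eval R p c \<odot>\<^bsub>M\<^esub> v"
    unfolding lin_comb_def by blast
  have iff: "?L c \<in> W \<longleftrightarrow> mpoly_eval R p c = \<zero>" if c: "c \<in> coords R ?n" for c
  proof -
    let ?a = "mpoly_eval R p c"
    have ac: "?a \<in> carrier R" by (rule mpoly_eval_closed[OF p c])
    obtain w where w: "w \<in> W" "?L c = w \<oplus>\<^bsub>M\<^esub> ?a \<odot>\<^bsub>M\<^esub> v" using pe[OF c] by blast
    have wc: "w \<in> carrier M" using w WE(1) by blast
    show ?thesis
    proof
      assume "?L c \<in> W"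
      hence "?L c \<oplus>\<^bsub>M\<^esub> (\<ominus>\<^bsub>M\<^esub> w) \<in> W" using WE(3,5) w(1) by blast
      moreover have "?L c \<oplus>\<^bsub>M\<^esub> (\<ominus>\<^bsub>M\<^esub> w) = ?a \<odot>\<^bsub>M\<^esub> v"
        using wc ac v(1) unfolding w(2) by (simp add: M.a_comm[of w] M.a_assoc M.r_neg)
      ultimately have av: "?a \<odot>\<^bsub>M\<^esub> v \<in> W" by simp
      show "?a = \<zero>"
      proof (rule ccontr)
        assume "?a \<noteq> \<zero>"
        hence un: "?a \<in> Units R" using ac K.field_Units by simp
        hence "inv ?a \<odot>\<^bsub>M\<^esub> (?a \<odot>\<^bsub>M\<^esub> v) = v"
          using v(1) ac by (simp flip: smult_assoc1)
        thus False using WE(4)[OF R.Units_inv_closed[OF un] av] v(2) by simp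
      qed
    next
      assume "?a = \<zero>"
      thus "?L c \<in> W" using w wc v(1) by simp
    qed
  qed
  have "W = ?L ` zero_set R ?n {p}"
  proof (intro equalityI subsetI)
    fix x assume x: "x \<in> W"
    then obtain c where "c \<in> coords R ?n" "x = ?L c" using b WE(1) unfolding is_basis_def by blast
    thus "x \<in> ?L ` zero_set R ?n {p}" using iff x by (auto simp: zero_set_def)
  qed (use iff in \<open>auto simp: zero_set_def\<close>)
  thus ?thesis using p unfolding zariski_closed_def by (intro exI[of _ "{p}"]) auto
qed

text \<open>The counterpart of the hyperplane lemma for the fibres that carry the three-set topology.\<close>

lemma proper_subspace_dim_le_1:
  assumes K: "field R" and b: "is_basis R M bs" "length bs \<le> 1"
    and W: "submodule W R M" "W \<noteq> carrier M"
  shows "W = {\<zero>\<^bsub>M\<^esub>}"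
proof -
  interpret K: field R by fact
  have bs: "set bs \<subseteq> carrier M"
    and span: "\<And>x. x \<in> carrier M \<Longrightarrow> \<exists>c\<in>coords R (length bs). x = lin_comb M bs c"
    using b(1) by (auto simp: is_basis_def)
  have notW: "\<not> set bs \<subseteq> W"
    using lin_comb_in_submodule[OF W(1)] span W(2) submoduleE(1)[OF W(1)] by blast
  hence "length bs = 1" using b(2) by (cases bs) auto
  then obtain u where u: "bs = [u]" by (cases bs) auto
  have uc: "u \<in> carrier M" "u \<notin> W" using bs notW u by auto
  have "w = \<zero>\<^bsub>M\<^esub>" if w: "w \<in> W" for w
  proof (rule ccontr)
    assume nz: "w \<noteq> \<zero>\<^bsub>M\<^esub>"
    have "w \<in> carrier M" using w submoduleE(1)[OF W(1)] by blast
    then obtain c where c: "c \<in> coords R (length bs)" "w = lin_comb M bs c" using span by blast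
    have c0: "c 0 \<in> carrier R" using c(1) u by (auto simp: coords_def)
    have wu: "w = c 0 \<odot>\<^bsub>M\<^esub> u"
      unfolding c(2) lin_comb_def u using uc(1) c0 by (simp add: lessThan_Suc)
    have "c 0 \<noteq> \<zero>" using wu nz uc(1) by auto
    hence un: "c 0 \<in> Units R" using c0 K.field_Units by simp
    have "inv (c 0) \<odot>\<^bsub>M\<^esub> w = u" unfolding wu using uc(1) c0 un by (simp flip: smult_assoc1)
    thus False using submoduleE(4)[OF W(1) R.Units_inv_closed[OF un] w] uc(2) by simp
  qed
  thus ?thesis using submodule_zero[OF W(1)] by blast
qed

text \<open>If two basis vectors were \<open>a v\<close> and \<open>a' v\<close>, then \<open>a'\<close> times the first would equal \<open>a\<close> times the
  second, which independence allows only when \<open>a\<close> and \<open>a'\<close> vanish.\<close>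

lemma cyclic_submodule_proper:
  assumes K: "field R" and b: "is_basis R M bs" "2 \<le> length bs" and v: "v \<in> carrier M"
  shows "module_span R M {v} \<noteq> carrier M"
proof
  interpret K: field R by fact
  assume span: "module_span R M {v} = carrier M"
  let ?n = "length bs" and ?L = "lin_comb M bs"
  have bs: "set bs \<subseteq> carrier M" using b(1) by (simp add: is_basis_def)
  have inj: "inj_on ?L (coords R ?n)" using basis_bij_betw[OF b(1)] by (simp add: bij_betw_def)
  have mult: "\<exists>a\<in>carrier R. x = a \<odot>\<^bsub>M\<^esub> v" if x: "x \<in> carrier M" for x
  proof -
    obtain c where c: "c \<in> coords R (length [v])" "x = lin_comb M [v] c"
      using module_span_lin_comb[of "[v]" x] span v x by auto
    have "c 0 \<in> carrier R" using c(1) by (auto simp: coords_def)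
    thus ?thesis using c(2) v by (intro bexI[of _ "c 0"]) (auto simp: lin_comb_def lessThan_Suc)
  qed
  let ?e = "\<lambda>i. \<lambda>j\<in>{..<?n}. if j = i then \<one> else \<zero>"
  have e: "?e i \<in> coords R ?n" for i by (rule coordsI) simp
  have Le: "?L (?e 0) = bs ! 0" "?L (?e 1) = bs ! 1"
    using lin_comb_unit[OF bs, of 0] lin_comb_unit[OF bs, of 1] b(2) by linarith+
  have "bs ! 0 \<in> carrier M" "bs ! 1 \<in> carrier M"
    using bs b(2) nth_mem[of 0 bs] nth_mem[of 1 bs] by fastforce+
  then obtain a a' where a: "a \<in> carrier R" "a' \<in> carrier R" "bs ! 0 = a \<odot>\<^bsub>M\<^esub> v" "bs ! 1 = a' \<odot>\<^bsub>M\<^esub> v"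
    using mult by metis
  let ?f = "\<lambda>b i. \<lambda>j\<in>{..<?n}. b \<otimes> ?e i j"
  have f: "?f b i \<in> coords R ?n" if "b \<in> carrier R" for b i by (rule coordsI) (use that in auto)
  have "a' \<odot>\<^bsub>M\<^esub> ?L (?e 0) = a \<odot>\<^bsub>M\<^esub> ?L (?e 1)"
    unfolding Le a(3,4) using a(1,2) v by (simp add: R.m_comm flip: smult_assoc1)
  hence "?L (?f a' 0) = ?L (?f a 1)"
    unfolding lin_comb_smult[OF bs e a(1)] lin_comb_smult[OF bs e a(2)] .
  hence eq: "?f a' 0 = ?f a 1" using inj f a by (meson inj_onD)
  have l: "0 < ?n" "1 < ?n" using b(2) by linarith+
  have "a' = \<zero>" using fun_cong[OF eq, of 0] a l by simp
  moreover have "a = \<zero>" using fun_cong[OF eq, of 1] a l by simp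
  ultimately have "?L (?e 0) = ?L (?e 1)" unfolding Le a(3,4) by simp
  hence "?e 0 = ?e 1" using inj e by (meson inj_onD)
  from fun_cong[OF this, of 0] l show False by simp
qed

lemma finite_carrier_of_basis:
  assumes "is_basis R M bs" "finite (carrier R)"
  shows "finite (carrier M)"
proof -
  have "finite (coords R (length bs))" unfolding coords_def using assms(2) by (intro finite_PiE) auto
  thus ?thesis using bij_betw_finite[OF basis_bij_betw[OF assms(1)]] by simp
qed

end

section \<open>The induced Zariski topology\<close>

lemma reducible_space_iff_open:
  "reducible_space T \<longleftrightarrow>
    (\<exists>U V. openin T U \<and> U \<noteq> {} \<and> openin T V \<and> V \<noteq> {} \<and> U \<inter> V = {})"
proof
  assume "reducible_space T"
  then obtain A B where AB: "closedin T A" "A \<noteq> topspace T" "closedin T B" "B \<noteq> topspace T"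
    "A \<union> B = topspace T" by (auto simp: reducible_space_def)
  have "A \<subseteq> topspace T" "B \<subseteq> topspace T" using AB by blast+
  hence "topspace T - A \<noteq> {}" "topspace T - B \<noteq> {}" "(topspace T - A) \<inter> (topspace T - B) = {}"
    using AB by blast+
  moreover have "openin T (topspace T - A)" "openin T (topspace T - B)"
    using AB by (simp_all add: openin_diff)
  ultimately show "\<exists>U V. openin T U \<and> U \<noteq> {} \<and> openin T V \<and> V \<noteq> {} \<and> U \<inter> V = {}" by blast
next
  assume "\<exists>U V. openin T U \<and> U \<noteq> {} \<and> openin T V \<and> V \<noteq> {} \<and> U \<inter> V = {}"
  then obtain U V where UV: "openin T U" "U \<noteq> {}" "openin T V" "V \<noteq> {}" "U \<inter> V = {}" by blast
  have "U \<subseteq> topspace T" "V \<subseteq> topspace T" using UV openin_subset by blast+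
  hence "topspace T - U \<noteq> topspace T" "topspace T - V \<noteq> topspace T"
    "(topspace T - U) \<union> (topspace T - V) = topspace T" using UV by blast+
  moreover have "closedin T (topspace T - U)" "closedin T (topspace T - V)"
    using UV by (simp_all add: closedin_diff)
  ultimately show "reducible_space T" unfolding reducible_space_def by blast
qed

text \<open>In an irreducible space, finite unions of proper closed sets stay proper.\<close>

lemma finite_closed_cover_imp_reducible:
  assumes fin: "finite \<C>" and closed: "\<And>C. C \<in> \<C> \<Longrightarrow> closedin T C \<and> C \<noteq> topspace T"
    and cover: "\<Union>\<C> = topspace T" and ne: "topspace T \<noteq> {}"
  shows "reducible_space T"
proof (rule ccontr)
  assume irr: "\<not> reducible_space T"
  have "closedin T (\<Union>\<C>) \<and> \<Union>\<C> \<noteq> topspace T"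
    using fin closed
  proof (induction \<C> rule: finite_induct)
    case empty
    show ?case using ne by (metis Union_empty closedin_empty)
  next
    case (insert C \<C>)
    hence "closedin T C" "C \<noteq> topspace T" "closedin T (\<Union>\<C>)" "\<Union>\<C> \<noteq> topspace T" by auto
    thus ?case using irr unfolding reducible_space_def by auto
  qed
  thus False using cover by blast
qed

context Module.module
begin

lemma mSpecD:
  assumes "I \<in> mSpec R"
  shows "maximalideal I R" "ideal I R" "field (R Quot I)"
proof -
  show I: "maximalideal I R" using assms by (simp add: mSpec_def)
  thus "ideal I R" by (simp add: maximalideal_def)
  show "field (R Quot I)" by (rule maximalideal.quotient_is_field[OF I R.is_cring])
qed

text \<open>The dimension and the topology of a fibre refer to a chosen basis; this says that the choice
  succeeds.\<close>

lemma fibre_module_basis: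
  assumes fg: "fin_gen_module R M" and I: "I \<in> mSpec R"
  shows "is_basis (R Quot I) (quot_module R M I) (some_basis (R Quot I) (quot_module R M I))"
proof -
  interpret Q: Module.module "R Quot I" "quot_module R M I"
    by (rule quot_module_module[OF mSpecD(2)[OF I]])
  show ?thesis
    by (rule Q.is_basis_some_basis[OF mSpecD(3)[OF I] quot_module_fin_gen[OF mSpecD(2)[OF I] fg]])
qed

lemma topspace_fibre_topology:
  assumes fg: "fin_gen_module R M" and I: "I \<in> mSpec R"
  shows "topspace (fibre_topology R M I) = residue R M I ` carrier M"
proof -
  interpret Q: Module.module "R Quot I" "quot_module R M I" by (rule quot_module_module[OF mSpecD(2)[OF I]])
  interpret K: field "R Quot I" by (rule mSpecD(3)[OF I])
  have "topspace (fibre_topology R M I) = carrier (quot_module R M I)"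
    using Q.closedin_zariski_topology(1)[OF K.domain_axioms fibre_module_basis[OF fg I]]
      closedin_three_set_topology(1)[OF Q.M.zero_closed] by (simp add: fibre_topology_def)
  thus ?thesis by (simp only: carrier_quot_module)
qed

lemma fibre_topology_irreducible:
  assumes fg: "fin_gen_module R M" and I: "I \<in> mSpec R"
    and inf: "I \<in> S_set R M \<Longrightarrow> infinite (carrier (R Quot I))"
  shows "\<not> reducible_space (fibre_topology R M I)"
proof -
  interpret Q: Module.module "R Quot I" "quot_module R M I" by (rule quot_module_module[OF mSpecD(2)[OF I]])
  show ?thesis
    using Q.zariski_topology_irreducible[OF mSpecD(3)[OF I] inf fibre_module_basis[OF fg I]]
      three_set_topology_irreducible[OF Q.M.zero_closed] by (simp add: fibre_topology_def)
qed

lemma residues_in_topspace: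
  assumes fg: "fin_gen_module R M" and x: "x \<in> carrier M"
  shows "(\<lambda>I\<in>mSpec R. residue R M I x) \<in> topspace (product_topology (fibre_topology R M) (mSpec R))"
  using topspace_fibre_topology[OF fg] x by (auto simp: topspace_product_topology)

lemma topspace_induced_zariski:
  assumes fg: "fin_gen_module R M"
  shows "topspace (induced_zariski R M) = carrier M"
  unfolding induced_zariski_def topspace_pullback_topology using residues_in_topspace[OF fg] by blast

lemma closedin_residue_vimage:
  assumes fg: "fin_gen_module R M" and I: "I \<in> mSpec R" and C: "closedin (fibre_topology R M I) C"
  shows "closedin (induced_zariski R M) {x \<in> carrier M. residue R M I x \<in> C}"
proof -
  let ?T = "product_topology (fibre_topology R M) (mSpec R)"
  have "continuous_map ?T (fibre_topology R M I) (\<lambda>f. f I)"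
    by (rule continuous_map_product_projection[OF I])
  hence "continuous_map (induced_zariski R M) (fibre_topology R M I)
      ((\<lambda>f. f I) \<circ> (\<lambda>x. \<lambda>I\<in>mSpec R. residue R M I x))"
    unfolding induced_zariski_def by (rule continuous_map_pullback)
  hence "closedin (induced_zariski R M) {x \<in> topspace (induced_zariski R M).
      ((\<lambda>f. f I) \<circ> (\<lambda>x. \<lambda>I\<in>mSpec R. residue R M I x)) x \<in> C}"
    using C by (rule closedin_continuous_map_preimage)
  thus ?thesis using I by (simp add: topspace_induced_zariski[OF fg])
qed

text \<open>Two nonempty basic open sets constrain only finitely many residues. Over each maximal ideal the
  two constraints can be met together because the fibre is irreducible, and by the Chinese remainder
  theorem one element of \<open>M\<close> meets all of them.\<close>

lemma induced_zariski_irreducible: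
  assumes fg: "fin_gen_module R M"
    and inf: "\<And>I. I \<in> S_set R M \<Longrightarrow> infinite (carrier (R Quot I))"
  shows "\<not> reducible_space (induced_zariski R M)"
proof
  let ?r = "\<lambda>x. \<lambda>I\<in>mSpec R. residue R M I x"
  let ?T = "product_topology (fibre_topology R M) (mSpec R)"
  let ?F = "fibre_topology R M"
  assume "reducible_space (induced_zariski R M)"
  then obtain U V x y where U: "openin ?T U" "?r x \<in> U" "x \<in> carrier M"
    and V: "openin ?T V" "?r y \<in> V" "y \<in> carrier M"
    and disj: "\<And>z. z \<in> carrier M \<Longrightarrow> ?r z \<in> U \<Longrightarrow> ?r z \<in> V \<Longrightarrow> False"
    unfolding reducible_space_iff_open induced_zariski_def openin_pullback_topology by blast
  obtain A where A: "finite {I \<in> mSpec R. A I \<noteq> topspace (?F I)}"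
    "\<And>I. I \<in> mSpec R \<Longrightarrow> openin (?F I) (A I)" "?r x \<in> Pi\<^sub>E (mSpec R) A" "Pi\<^sub>E (mSpec R) A \<subseteq> U"
    using U(1,2) unfolding openin_product_topology_alt by meson
  obtain B where B: "finite {I \<in> mSpec R. B I \<noteq> topspace (?F I)}"
    "\<And>I. I \<in> mSpec R \<Longrightarrow> openin (?F I) (B I)" "?r y \<in> Pi\<^sub>E (mSpec R) B" "Pi\<^sub>E (mSpec R) B \<subseteq> V"
    using V(1,2) unfolding openin_product_topology_alt by meson
  \<comment> \<open>The ideals at which at least one of the two boxes imposes a condition.\<close>
  let ?E = "{I \<in> mSpec R. A I \<noteq> topspace (?F I)} \<union> {I \<in> mSpec R. B I \<noteq> topspace (?F I)}"
  have "\<exists>t\<in>carrier M. residue R M I t \<in> A I \<inter> B I" if I: "I \<in> mSpec R" for I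
  proof -
    have "A I \<noteq> {}" "B I \<noteq> {}" using A(3) B(3) I by (auto simp: PiE_def Pi_def)
    moreover have "\<not> reducible_space (?F I)" by (rule fibre_topology_irreducible[OF fg I inf])
    ultimately have "A I \<inter> B I \<noteq> {}"
      using A(2)[OF I] B(2)[OF I] unfolding reducible_space_iff_open by blast
    then obtain w where w: "w \<in> A I \<inter> B I" by blast
    hence "w \<in> topspace (?F I)" using openin_subset[OF A(2)[OF I]] by blast
    thus ?thesis using w unfolding topspace_fibre_topology[OF fg I] by blast
  qed
  then obtain t where t: "\<And>I. I \<in> mSpec R \<Longrightarrow> t I \<in> carrier M"
    "\<And>I. I \<in> mSpec R \<Longrightarrow> residue R M I (t I) \<in> A I \<inter> B I" by metis
  have "finite ?E" using A(1) B(1) by simp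
  hence "\<exists>z\<in>carrier M. \<forall>I\<in>?E. residue R M I z = residue R M I (t I)"
    by (rule residues_surjective) (use mSpecD(1) t(1) in auto)
  then obtain z where z: "z \<in> carrier M" "\<And>I. I \<in> ?E \<Longrightarrow> residue R M I z = residue R M I (t I)"
    by blast
  have zAB: "residue R M I z \<in> A I \<inter> B I" if I: "I \<in> mSpec R" for I
  proof (cases "I \<in> ?E")
    case True
    thus ?thesis using z(2) t(2)[OF I] by simp
  next
    case False
    thus ?thesis using I z(1) by (simp add: topspace_fibre_topology[OF fg I])
  qed
  have "?r z \<in> Pi\<^sub>E (mSpec R) A" "?r z \<in> Pi\<^sub>E (mSpec R) B" using zAB by auto
  thus False using disj[OF z(1)] A(4) B(4) by blast
qed

section \<open>Maximal submodules are closed\<close>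

text \<open>The quotient \<open>M/P\<close> is simple, hence isomorphic to \<open>R/I\<close> for the annihilator \<open>I\<close> of a nonzero
  element of it. So \<open>I\<close> is a maximal ideal with \<open>IM \<subseteq> P\<close>, and \<open>P\<close> is the preimage of the hyperplane
  \<open>P/IM\<close> of \<open>M/IM\<close>. A hyperplane is closed in both kinds of fibre: in dimension at least 2 it is the zero
  set of a linear form, and in dimension 1 it is \<open>{0}\<close>.\<close>

lemma maximal_submodule_closed:
  assumes fg: "fin_gen_module R M" and P: "submodule P R M" "P \<noteq> carrier M"
    and max: "\<And>Q. submodule Q R M \<Longrightarrow> P \<subseteq> Q \<Longrightarrow> Q = P \<or> Q = carrier M"
  shows "closedin (induced_zariski R M) P"
proof -
  note PE = submoduleE[OF P(1)]
  note P0 = submodule_zero[OF P(1)]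
  obtain v where v: "v \<in> carrier M" "v \<notin> P" using P(2) PE(1) by blast
  \<comment> \<open>Simplicity of \<open>M/P\<close>: each element outside \<open>P\<close> generates \<open>M\<close> modulo \<open>P\<close>.\<close>
  have dec: "\<exists>b\<in>carrier R. \<exists>p\<in>P. x = p \<oplus>\<^bsub>M\<^esub> b \<odot>\<^bsub>M\<^esub> u"
    if u: "u \<in> carrier M" "u \<notin> P" and x: "x \<in> carrier M" for u x
  proof -
    let ?Q = "{p \<oplus>\<^bsub>M\<^esub> b \<odot>\<^bsub>M\<^esub> u | p b. p \<in> P \<and> b \<in> carrier R}"
    have QI: "p \<oplus>\<^bsub>M\<^esub> b \<odot>\<^bsub>M\<^esub> u \<in> ?Q" if "p \<in> P" "b \<in> carrier R" for p b using that by blast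
    have "submodule ?Q R M"
    proof (rule submoduleI)
      show "?Q \<subseteq> carrier M" using PE(1) u(1) by auto
      show "\<zero>\<^bsub>M\<^esub> \<in> ?Q" using QI[OF P0 R.zero_closed] u(1) by simp
      show sm: "a \<odot>\<^bsub>M\<^esub> q \<in> ?Q" if a: "a \<in> carrier R" and q: "q \<in> ?Q" for a q
      proof -
        obtain p b where pb: "p \<in> P" "b \<in> carrier R" "q = p \<oplus>\<^bsub>M\<^esub> b \<odot>\<^bsub>M\<^esub> u" using q by blast
        have "p \<in> carrier M" using pb PE(1) by blast
        hence "a \<odot>\<^bsub>M\<^esub> q = a \<odot>\<^bsub>M\<^esub> p \<oplus>\<^bsub>M\<^esub> (a \<otimes> b) \<odot>\<^bsub>M\<^esub> u"
          using pb a u(1) by (simp add: smult_r_distr smult_assoc1)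
        thus ?thesis using QI[OF PE(4)[OF a pb(1)], of "a \<otimes> b"] a pb(2) by simp
      qed
      show "\<ominus>\<^bsub>M\<^esub> q \<in> ?Q" if q: "q \<in> ?Q" for q
      proof -
        have "q \<in> carrier M" using q PE(1) u(1) by auto
        thus ?thesis using sm[of "\<ominus> \<one>" q] q by (simp add: smult_l_minus)
      qed
      show "q \<oplus>\<^bsub>M\<^esub> q' \<in> ?Q" if q: "q \<in> ?Q" "q' \<in> ?Q" for q q'
      proof -
        obtain p b p' b' where pb: "p \<in> P" "b \<in> carrier R" "q = p \<oplus>\<^bsub>M\<^esub> b \<odot>\<^bsub>M\<^esub> u"
          "p' \<in> P" "b' \<in> carrier R" "q' = p' \<oplus>\<^bsub>M\<^esub> b' \<odot>\<^bsub>M\<^esub> u" using q by blast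
        have "p \<in> carrier M" "p' \<in> carrier M" using pb PE(1) by auto
        hence "q \<oplus>\<^bsub>M\<^esub> q' = (p \<oplus>\<^bsub>M\<^esub> p') \<oplus>\<^bsub>M\<^esub> (b \<oplus> b') \<odot>\<^bsub>M\<^esub> u"
          using pb u(1) by (simp add: smult_l_distr M.a_ac)
        thus ?thesis using QI[OF PE(5)[OF pb(1,4)], of "b \<oplus> b'"] pb(2,5) by simp
      qed
    qed
    moreover have "P \<subseteq> ?Q"
    proof
      fix p assume p: "p \<in> P"
      have "p \<in> carrier M" using p PE(1) by blast
      thus "p \<in> ?Q" using QI[OF p R.zero_closed] u(1) by simp
    qed
    moreover have "u \<in> ?Q" using QI[OF P0 R.one_closed] u(1) by simp
    ultimately have "?Q = carrier M" using max u(2) by blast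
    thus ?thesis using x by blast
  qed
  define I where "I = {a \<in> carrier R. a \<odot>\<^bsub>M\<^esub> v \<in> P}"
  have id: "ideal I R"
  proof (rule idealI)
    show "ring R" by (rule R.ring_axioms)
    show "subgroup I (add_monoid R)"
    proof (rule R.add.subgroupI)
      show "I \<subseteq> carrier R" by (auto simp: I_def)
      show "I \<noteq> {}" using P0 v(1) by (auto simp: I_def intro!: exI[of _ \<zero>])
      show "\<ominus> a \<in> I" if "a \<in> I" for a
        using that PE(3) v(1) by (auto simp: I_def smult_l_minus)
      show "a \<oplus> b \<in> I" if "a \<in> I" "b \<in> I" for a b
        using that PE(5) v(1) by (auto simp: I_def smult_l_distr)
    qed
    show r: "b \<otimes> a \<in> I" if "a \<in> I" "b \<in> carrier R" for a b
      using that PE(4) v(1) by (auto simp: I_def smult_assoc1)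
    show "a \<otimes> b \<in> I" if "a \<in> I" "b \<in> carrier R" for a b
      using r[OF that] that by (simp add: I_def R.m_comm)
  qed
  have one: "\<one> \<notin> I" using v by (simp add: I_def)
  have I: "I \<in> mSpec R"
    unfolding mSpec_def mem_Collect_eq
  proof (rule maximalidealI[OF id])
    show "carrier R \<noteq> I" using one by blast
    fix J assume J: "ideal J R" "I \<subseteq> J" "J \<subseteq> carrier R"
    interpret J: ideal J R by fact
    show "J = I \<or> J = carrier R"
    proof (cases "J = I")
      case False
      then obtain a where a: "a \<in> J" "a \<notin> I" using J(2) by blast
      have ac: "a \<in> carrier R" using a J(3) by blast
      have av: "a \<odot>\<^bsub>M\<^esub> v \<in> carrier M" "a \<odot>\<^bsub>M\<^esub> v \<notin> P" using a(2) ac v(1) by (auto simp: I_def)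
      obtain b p where b: "b \<in> carrier R" and p: "p \<in> P" "v = p \<oplus>\<^bsub>M\<^esub> b \<odot>\<^bsub>M\<^esub> (a \<odot>\<^bsub>M\<^esub> v)"
        using dec[OF av v(1)] by blast
      have pc: "p \<in> carrier M" using p PE(1) by blast
      let ?d = "\<one> \<oplus> (\<ominus> (b \<otimes> a))"
      have "?d \<odot>\<^bsub>M\<^esub> v = v \<oplus>\<^bsub>M\<^esub> (\<ominus>\<^bsub>M\<^esub> (b \<odot>\<^bsub>M\<^esub> (a \<odot>\<^bsub>M\<^esub> v)))"
        using b ac v(1) by (simp add: smult_l_distr smult_l_minus smult_assoc1)
      also have "\<dots> = (p \<oplus>\<^bsub>M\<^esub> b \<odot>\<^bsub>M\<^esub> (a \<odot>\<^bsub>M\<^esub> v)) \<oplus>\<^bsub>M\<^esub> (\<ominus>\<^bsub>M\<^esub> (b \<odot>\<^bsub>M\<^esub> (a \<odot>\<^bsub>M\<^esub> v)))"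
        using p(2) by simp
      also have "\<dots> = p" using pc b av(1) by (simp add: M.a_assoc M.r_neg)
      finally have "?d \<odot>\<^bsub>M\<^esub> v \<in> P" using p(1) by simp
      hence "?d \<in> J" using b ac J(2) by (auto simp: I_def)
      hence "?d \<oplus> b \<otimes> a \<in> J" using J.I_l_closed[OF a(1) b] by (rule J.a_closed)
      hence "\<one> \<in> J" using b ac by (simp add: R.a_assoc R.l_neg)
      hence "J = carrier R" by (rule J.one_imp_carrier)
      thus ?thesis ..
    qed simp
  qed
  have IM: "ideal_smult R M I \<subseteq> P"
    unfolding ideal_smult_def
  proof (rule module_span_least[OF P(1)], clarify)
    fix a x assume a: "a \<in> I" and x: "x \<in> carrier M"
    obtain b p where b: "b \<in> carrier R" and p: "p \<in> P" "x = p \<oplus>\<^bsub>M\<^esub> b \<odot>\<^bsub>M\<^esub> v" using dec[OF v x] by blast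
    have ac: "a \<in> carrier R" "a \<odot>\<^bsub>M\<^esub> v \<in> P" using a by (auto simp: I_def)
    have pc: "p \<in> carrier M" using p PE(1) by blast
    have "a \<odot>\<^bsub>M\<^esub> x = a \<odot>\<^bsub>M\<^esub> p \<oplus>\<^bsub>M\<^esub> b \<odot>\<^bsub>M\<^esub> (a \<odot>\<^bsub>M\<^esub> v)"
      unfolding p(2) using ac(1) b pc v(1)
      by (simp add: smult_r_distr R.m_comm flip: smult_assoc1)
    thus "a \<odot>\<^bsub>M\<^esub> x \<in> P" using PE(4,5) p(1) ac b by simp
  qed
  interpret Q: Module.module "R Quot I" "quot_module R M I" by (rule quot_module_module[OF id])
  interpret K: field "R Quot I" by (rule mSpecD(3)[OF I])
  let ?W = "residue R M I ` P"
  note bas = fibre_module_basis[OF fg I]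
  have mem: "residue R M I x \<in> ?W \<longleftrightarrow> x \<in> P" if "x \<in> carrier M" for x
    by (rule residue_mem_image_iff[OF id P(1) IM that])
  have W: "submodule ?W (R Quot I) (quot_module R M I)" by (rule residue_image_submodule[OF id P(1)])
  have vW: "residue R M I v \<in> carrier (quot_module R M I)" "residue R M I v \<notin> ?W"
    using v mem by (auto simp: carrier_quot_module)
  have "closedin (fibre_topology R M I) ?W"
  proof (cases "I \<in> S_set R M")
    case True
    have "zariski_closed (R Quot I) (quot_module R M I) (some_basis (R Quot I) (quot_module R M I)) ?W"
    proof (rule Q.zariski_closed_hyperplane[OF K.field_axioms bas W vW])
      fix y assume "y \<in> carrier (quot_module R M I)"
      then obtain x where x: "x \<in> carrier M" "y = residue R M I x" by (auto simp: carrier_quot_module)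
      obtain b p where b: "b \<in> carrier R" and p: "p \<in> P" "x = p \<oplus>\<^bsub>M\<^esub> b \<odot>\<^bsub>M\<^esub> v"
        using dec[OF v x(1)] by blast
      have "p \<in> carrier M" using p PE(1) by blast
      hence "y = residue R M I p \<oplus>\<^bsub>quot_module R M I\<^esub> (I +> b) \<odot>\<^bsub>quot_module R M I\<^esub> residue R M I v"
        unfolding x(2) p(2) using b v(1) by (simp add: residue_add[OF id] quot_module_smult[OF id])
      moreover have "I +> b \<in> carrier (R Quot I)" using b by (simp add: carrier_FactRing)
      ultimately show "\<exists>a\<in>carrier (R Quot I). \<exists>w\<in>?W.
          y = w \<oplus>\<^bsub>quot_module R M I\<^esub> a \<odot>\<^bsub>quot_module R M I\<^esub> residue R M I v" using p(1) by blast
    qed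
    thus ?thesis using Q.closedin_zariski_topology(2)[OF K.domain_axioms bas] True
      by (simp add: fibre_topology_def)
  next
    case False
    hence "length (some_basis (R Quot I) (quot_module R M I)) \<le> 1"
      using I by (simp add: S_set_def vdim_def)
    hence "?W = {\<zero>\<^bsub>quot_module R M I\<^esub>}"
      using Q.proper_subspace_dim_le_1[OF K.field_axioms bas _ W] vW by blast
    thus ?thesis using closedin_three_set_topology(2)[OF Q.M.zero_closed] False
      by (simp add: fibre_topology_def)
  qed
  hence "closedin (induced_zariski R M) {x \<in> carrier M. residue R M I x \<in> ?W}"
    by (rule closedin_residue_vimage[OF fg I])
  moreover have "{x \<in> carrier M. residue R M I x \<in> ?W} = P" using mem PE(1) by blast
  ultimately show ?thesis by simp
qed

section \<open>Finite covers\<close>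

text \<open>Enlarge each submodule of the cover to a maximal one; maximal submodules are closed.\<close>

lemma finite_submodule_cover_imp_reducible:
  assumes fg: "fin_gen_module R M"
    and \<C>: "finite \<C>" "\<And>N. N \<in> \<C> \<Longrightarrow> submodule N R M \<and> N \<noteq> carrier M" "\<Union>\<C> = carrier M"
  shows "reducible_space (induced_zariski R M)"
proof -
  have "\<forall>N\<in>\<C>. \<exists>P. closedin (induced_zariski R M) P \<and> P \<noteq> carrier M \<and> N \<subseteq> P"
  proof
    fix N assume "N \<in> \<C>"
    then obtain P where P: "submodule P R M" "P \<noteq> carrier M" "N \<subseteq> P"
      and max: "\<forall>Q. submodule Q R M \<and> P \<subseteq> Q \<longrightarrow> Q = P \<or> Q = carrier M"
      using exists_maximal_submodule[OF fg, of N] \<C>(2) by blast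
    have "closedin (induced_zariski R M) P"
      by (rule maximal_submodule_closed[OF fg P(1,2)]) (use max in blast)
    thus "\<exists>P. closedin (induced_zariski R M) P \<and> P \<noteq> carrier M \<and> N \<subseteq> P" using P by blast
  qed
  then obtain P where P: "\<forall>N\<in>\<C>. closedin (induced_zariski R M) (P N) \<and> P N \<noteq> carrier M \<and> N \<subseteq> P N"
    by (rule bchoice[THEN exE])
  note top = topspace_induced_zariski[OF fg]
  show ?thesis
  proof (rule finite_closed_cover_imp_reducible)
    show "finite (P ` \<C>)" using \<C>(1) by simp
    show "closedin (induced_zariski R M) C \<and> C \<noteq> topspace (induced_zariski R M)" if "C \<in> P ` \<C>" for C
      using that P by (auto simp: top)
    show "\<Union> (P ` \<C>) = topspace (induced_zariski R M)"
    proof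
      show "\<Union> (P ` \<C>) \<subseteq> topspace (induced_zariski R M)"
      proof (rule UN_least)
        fix N assume "N \<in> \<C>"
        thus "P N \<subseteq> topspace (induced_zariski R M)" using P by (intro closedin_subset) simp
      qed
      have "\<Union>\<C> \<subseteq> \<Union> (P ` \<C>)" using P by auto
      thus "topspace (induced_zariski R M) \<subseteq> \<Union> (P ` \<C>)" by (simp add: top \<C>(3))
    qed
    show "topspace (induced_zariski R M) \<noteq> {}"
      using M.zero_closed unfolding top by (rule ex_in_conv[THEN iffD1, OF exI])
  qed
qed

text \<open>The vector space \<open>M/IM\<close> has finitely many elements, hence finitely many cyclic subspaces. These
  cover it, and each is proper because the dimension is at least 2. Their preimages cover \<open>M\<close>.\<close>

lemma finite_residue_field_imp_submodule_cover:
  assumes fg: "fin_gen_module R M" and I: "I \<in> S_set R M" and fin: "finite (carrier (R Quot I))"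
  shows "\<exists>\<C> \<subseteq> {N. submodule N R M \<and> N \<noteq> carrier M}. finite \<C> \<and> \<Union>\<C> = carrier M"
proof -
  have Im: "I \<in> mSpec R" using I by (simp add: S_set_def)
  note id = mSpecD(2)[OF Im]
  interpret Q: Module.module "R Quot I" "quot_module R M I" by (rule quot_module_module[OF id])
  note bas = fibre_module_basis[OF fg Im]
  let ?V = "carrier (quot_module R M I)"
  let ?N = "\<lambda>v. {x \<in> carrier M. residue R M I x \<in> module_span (R Quot I) (quot_module R M I) {v}}"
  have N: "submodule (?N v) R M \<and> ?N v \<noteq> carrier M" if v: "v \<in> ?V" for v
  proof
    have sp: "submodule (module_span (R Quot I) (quot_module R M I) {v}) (R Quot I) (quot_module R M I)"
      by (rule Q.module_span_submodule) (use v in simp)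
    show "submodule (?N v) R M" by (rule residue_vimage_submodule[OF id sp])
    have "2 \<le> length (some_basis (R Quot I) (quot_module R M I))"
      using I by (simp add: S_set_def vdim_def)
    hence "module_span (R Quot I) (quot_module R M I) {v} \<noteq> ?V"
      by (rule Q.cyclic_submodule_proper[OF mSpecD(3)[OF Im] bas _ v])
    hence "\<not> ?V \<subseteq> module_span (R Quot I) (quot_module R M I) {v}" using Q.submoduleE(1)[OF sp] by blast
    thus "?N v \<noteq> carrier M" unfolding carrier_quot_module by blast
  qed
  have "\<Union> (?N ` ?V) = carrier M"
  proof
    show "carrier M \<subseteq> \<Union> (?N ` ?V)"
    proof
      fix x assume x: "x \<in> carrier M"
      hence "residue R M I x \<in> ?V" by (simp add: carrier_quot_module)
      moreover have "x \<in> ?N (residue R M I x)"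
        using x Q.module_span_superset[of "{residue R M I x}"] by simp
      ultimately show "x \<in> \<Union> (?N ` ?V)" by blast
    qed
  qed blast
  moreover have "finite (?N ` ?V)" using Q.finite_carrier_of_basis[OF bas fin] by simp
  moreover have "?N ` ?V \<subseteq> {N. submodule N R M \<and> N \<noteq> carrier M}" using N by blast
  ultimately show ?thesis by (intro exI[of _ "?N ` ?V"]) simp
qed

end

section \<open>Covering numbers as cardinals\<close>

lemma card_of_ordLeq_finite:
  assumes A: "finite A" and AB: "finite B \<Longrightarrow> card A \<le> card B"
  shows "|A| \<le>o |B|"
proof -
  obtain B' where B': "finite B'" "B' \<subseteq> B" "card A \<le> card B'"
    using AB infinite_arbitrarily_large[of B "card A"] by (cases "finite B") auto
  obtain f where "f ` A \<subseteq> B'" "inj_on f A" using card_le_inj[OF A B'(1,3)] by blast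
  hence "inj_on f A \<and> f ` A \<subseteq> B" using B'(2) by blast
  thus ?thesis by (intro card_of_ordLeq[THEN iffD1] exI)
qed

text \<open>Among the finite covers, one of least size attains the minimum, and infinite covers are larger.\<close>

lemma finite_covering_number_iff:
  fixes S :: "'b set"
  shows "(\<exists>\<kappa> :: 'b set rel. is_covering_number \<P> S \<kappa> \<and> BNF_Cardinal_Arithmetic.cfinite \<kappa>)
    \<longleftrightarrow> (\<exists>\<C> \<subseteq> \<P>. finite \<C> \<and> \<Union>\<C> = S)"
proof
  assume "\<exists>\<kappa> :: 'b set rel. is_covering_number \<P> S \<kappa> \<and> BNF_Cardinal_Arithmetic.cfinite \<kappa>"
  then obtain \<kappa> :: "'b set rel" and \<C> where \<kappa>: "Card_order \<kappa>" "finite (Field \<kappa>)"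
    and \<C>: "\<C> \<subseteq> \<P>" "\<Union>\<C> = S" "|\<C>| =o \<kappa>"
    unfolding is_covering_number_def BNF_Cardinal_Arithmetic.cfinite_def by blast
  have "|\<C>| =o |Field \<kappa>|"
    by (rule ordIso_transitive[OF \<C>(3) ordIso_symmetric[OF card_of_Field_ordIso[OF \<kappa>(1)]]])
  hence "finite \<C>" using card_of_ordIso_finite[of \<C> "Field \<kappa>"] \<kappa>(2) by simp
  thus "\<exists>\<C> \<subseteq> \<P>. finite \<C> \<and> \<Union>\<C> = S" using \<C> by blast
next
  let ?P = "\<lambda>\<C>. \<C> \<subseteq> \<P> \<and> finite \<C> \<and> \<Union>\<C> = S"
  assume "\<exists>\<C> \<subseteq> \<P>. finite \<C> \<and> \<Union>\<C> = S"
  then obtain \<C>0 where "?P \<C>0" by blast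
  then obtain \<C> where \<C>: "?P \<C>" and least: "\<And>\<D>. ?P \<D> \<Longrightarrow> card \<C> \<le> card \<D>"
    using ex_has_least_nat[of ?P \<C>0 card] by blast
  have "|\<C>| \<le>o |\<D>|" if "\<D> \<subseteq> \<P>" "\<Union>\<D> = S" for \<D>
    by (rule card_of_ordLeq_finite) (use that least \<C> in auto)
  hence "is_covering_number \<P> S |\<C>|"
    unfolding is_covering_number_def
    using \<C> by (intro conjI exI[of _ \<C>] card_of_Card_order card_of_refl) auto
  moreover have "BNF_Cardinal_Arithmetic.cfinite |\<C>|"
    using \<C> by (simp add: BNF_Cardinal_Arithmetic.cfinite_def Field_card_of)
  ultimately show "\<exists>\<kappa> :: 'b set rel. is_covering_number \<P> S \<kappa> \<and> BNF_Cardinal_Arithmetic.cfinite \<kappa>"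
    by blast
qed

text \<open>The hypotheses exclude the covers by no set and by one set, so 2 is the least possible size.\<close>

lemma covering_number_two_iff:
  assumes ne: "S \<noteq> {}" and S: "S \<notin> \<P>"
  shows "is_covering_number \<P> S BNF_Cardinal_Arithmetic.ctwo \<longleftrightarrow> (\<exists>A\<in>\<P>. \<exists>B\<in>\<P>. A \<union> B = S)"
proof
  assume "is_covering_number \<P> S BNF_Cardinal_Arithmetic.ctwo"
  then obtain \<C> where \<C>: "\<C> \<subseteq> \<P>" "\<Union>\<C> = S" "|\<C>| =o |UNIV :: bool set|"
    unfolding is_covering_number_def BNF_Cardinal_Arithmetic.ctwo_def by blast
  from \<C>(3) obtain f :: "_ \<Rightarrow> bool" where "bij_betw f \<C> UNIV"
    by (rule card_of_ordIso[THEN iffD2, THEN exE])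
  hence "card \<C> = 2" using bij_betw_same_card by fastforce
  then obtain A B where "\<C> = {A, B}" by (auto simp: card_2_iff)
  thus "\<exists>A\<in>\<P>. \<exists>B\<in>\<P>. A \<union> B = S" using \<C> by auto
next
  assume "\<exists>A\<in>\<P>. \<exists>B\<in>\<P>. A \<union> B = S"
  then obtain A B where AB: "A \<in> \<P>" "B \<in> \<P>" "A \<union> B = S" by blast
  hence "A \<noteq> B" using S by auto
  hence "card {A, B} = card (UNIV :: bool set)" by simp
  hence "\<exists>f. bij_betw f {A, B} (UNIV :: bool set)" by (intro finite_same_card_bij) auto
  hence two: "|{A, B}| =o |UNIV :: bool set|" by (rule card_of_ordIso[THEN iffD1])
  have "|UNIV :: bool set| \<le>o |\<D>|" if \<D>: "\<D> \<subseteq> \<P>" "\<Union>\<D> = S" for \<D>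
  proof (rule card_of_ordLeq_finite)
    assume fin: "finite \<D>"
    have "\<D> \<noteq> {}" using \<D> ne by blast
    hence "card \<D> \<noteq> 0" using fin by simp
    moreover have "card \<D> \<noteq> 1"
    proof
      assume "card \<D> = 1"
      then obtain D where "\<D> = {D}" by (rule card_1_singletonE)
      thus False using \<D> S by auto
    qed
    ultimately show "card (UNIV :: bool set) \<le> card \<D>" by simp
  qed simp
  thus "is_covering_number \<P> S BNF_Cardinal_Arithmetic.ctwo"
    unfolding is_covering_number_def BNF_Cardinal_Arithmetic.ctwo_def
    using two AB card_of_Card_order by (intro conjI exI[of _ "{A, B}"]) auto
qed

theorem proposition6p23:
  fixes R :: "('a, 'm) ring_scheme" and M :: "('a, 'b, 'n) module_scheme"
  assumes "Module.module R M" and "fin_gen_module R M"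
  shows "(sigma_tau_fin R M \<longleftrightarrow> is_sigma_tau R M BNF_Cardinal_Arithmetic.ctwo)
    \<and> (is_sigma_tau R M BNF_Cardinal_Arithmetic.ctwo \<longleftrightarrow> reducible_space (induced_zariski R M))
    \<and> (is_sigma_tau R M BNF_Cardinal_Arithmetic.ctwo \<longleftrightarrow> sigma_fin R M)"
proof -
  interpret Module.module R M by fact
  note fg = assms(2)
  let ?T = "induced_zariski R M"
  let ?C = "{C. closedin ?T C \<and> C \<noteq> carrier M}"
  note top = topspace_induced_zariski[OF fg]
  have ne: "carrier M \<noteq> {}" using M.zero_closed by blast
  have two: "is_sigma_tau R M BNF_Cardinal_Arithmetic.ctwo \<longleftrightarrow> reducible_space ?T"
    unfolding is_sigma_tau_def reducible_space_def top
    using covering_number_two_iff[OF ne, of ?C] by blast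
  have tau: "sigma_tau_fin R M \<longleftrightarrow> (\<exists>\<C>\<subseteq>?C. finite \<C> \<and> \<Union>\<C> = carrier M)"
    unfolding sigma_tau_fin_def is_sigma_tau_def by (rule finite_covering_number_iff)
  have "sigma_tau_fin R M \<longleftrightarrow> reducible_space ?T"
  proof
    assume "sigma_tau_fin R M"
    then obtain \<C> where \<C>: "\<C> \<subseteq> ?C" "finite \<C>" "\<Union>\<C> = carrier M" using tau by blast
    show "reducible_space ?T"
      by (rule finite_closed_cover_imp_reducible[OF \<C>(2)]) (use \<C> ne in \<open>auto simp: top\<close>)
  next
    assume "reducible_space ?T"
    then obtain A B where "A \<in> ?C" "B \<in> ?C" "A \<union> B = carrier M"
      unfolding reducible_space_def top by blast
    hence "{A, B} \<subseteq> ?C" "finite {A, B}" "\<Union>{A, B} = carrier M" by auto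
    thus "sigma_tau_fin R M" unfolding tau by blast
  qed
  moreover have "sigma_fin R M \<longleftrightarrow> reducible_space ?T"
  proof -
    have sig: "sigma_fin R M \<longleftrightarrow>
        (\<exists>\<C>\<subseteq>{N. submodule N R M \<and> N \<noteq> carrier M}. finite \<C> \<and> \<Union>\<C> = carrier M)"
      unfolding sigma_fin_def is_sigma_def by (rule finite_covering_number_iff)
    show ?thesis
    proof
      assume "sigma_fin R M"
      then obtain \<C> where "\<C> \<subseteq> {N. submodule N R M \<and> N \<noteq> carrier M}" "finite \<C>" "\<Union>\<C> = carrier M"
        using sig by blast
      thus "reducible_space ?T" by (intro finite_submodule_cover_imp_reducible[OF fg]) auto
    next
      assume "reducible_space ?T"
      then obtain I where "I \<in> S_set R M" "finite (carrier (R Quot I))"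
        using induced_zariski_irreducible[OF fg] by blast
      thus "sigma_fin R M" unfolding sig by (rule finite_residue_field_imp_submodule_cover[OF fg])
    qed
  qed
  ultimately show ?thesis using two by blast
qed

end
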